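(* Let $p\geq 2$ and let $G$ be a finite simple $\{pK_2, \overline{P_5}\}$-free graph. Then $\chi(G)\leq f_p(\omega(G))$, where the functions $f_p$ ($p\geq2$) are defined by: $f_t(1)=1$ for $t\geq 2$; $f_2(s)=\frac{3}{2}s$ for $s\geq 2$; $f_p(2)=2p-2$ for $p\geq 3$; and $f_p(m)=m+\sum_{j=2}^{m} f_{p-1}(j)$ for $m,p\geq 3$.
   Context: $\chi(G)$ is the chromatic number and $\omega(G)$ the clique number of $G$. $pK_2$ is the disjoint union of $p$ edges. $\overline{P_5}$ is the complement of the path on five vertices (the "house"). A graph is $\mathcal{F}$-free if it has no induced subgraph isomorphic to a member of $\mathcal{F}$. *)

theory Defs
  imports Complex_Main
begin

type_synonym 'a graph = "'a set \<times> 'a set set"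

abbreviation verts :: "'a graph \<Rightarrow> 'a set" where
  "verts G \<equiv> fst G"

abbreviation edges :: "'a graph \<Rightarrow> 'a set set" where
  "edges G \<equiv> snd G"

definition finite_simple_graph :: "'a graph \<Rightarrow> bool" where
  "finite_simple_graph G \<longleftrightarrow>
     finite (verts G) \<and> (\<forall>e\<in>edges G. e \<subseteq> verts G \<and> card e = 2)"

definition induced_subgraph :: "'a graph \<Rightarrow> 'a set \<Rightarrow> 'a graph" where
  "induced_subgraph G S = (S, {e \<in> edges G. e \<subseteq> S})"

definition isomorphic :: "'a graph \<Rightarrow> 'b graph \<Rightarrow> bool" where
  "isomorphic G H \<longleftrightarrow>
     (\<exists>f. bij_betw f (verts G) (verts H) \<and>
          (\<forall>u\<in>verts G. \<forall>v\<in>verts G. {u, v} \<in> edges G \<longleftrightarrow> {f u, f v} \<in> edges H))"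

definition free_of :: "'b graph set \<Rightarrow> 'a graph \<Rightarrow> bool" where
  "free_of F G \<longleftrightarrow>
     \<not> (\<exists>H\<in>F. \<exists>S\<subseteq>verts G. isomorphic (induced_subgraph G S) H)"

definition complement_graph :: "'a graph \<Rightarrow> 'a graph" where
  "complement_graph G =
     (verts G, {{u, v} |u v. u \<in> verts G \<and> v \<in> verts G \<and> u \<noteq> v \<and> {u, v} \<notin> edges G})"

definition path_graph :: "nat \<Rightarrow> nat graph" where
  "path_graph n = ({..<n}, {{i, Suc i} |i. Suc i < n})"

definition pK2 :: "nat \<Rightarrow> nat graph" where
  "pK2 p = ({..<2 * p}, {{2 * i, 2 * i + 1} |i. i < p})"

definition clique :: "'a graph \<Rightarrow> 'a set \<Rightarrow> bool" where
  "clique G C \<longleftrightarrow>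
     C \<subseteq> verts G \<and> (\<forall>u\<in>C. \<forall>v\<in>C. u \<noteq> v \<longrightarrow> {u, v} \<in> edges G)"

definition clique_number :: "'a graph \<Rightarrow> nat" where
  "clique_number G = Max (card ` {C. clique G C})"

definition proper_colouring :: "'a graph \<Rightarrow> nat \<Rightarrow> ('a \<Rightarrow> nat) \<Rightarrow> bool" where
  "proper_colouring G k c \<longleftrightarrow>
     (\<forall>v\<in>verts G. c v < k) \<and> (\<forall>u v. {u, v} \<in> edges G \<longrightarrow> c u \<noteq> c v)"

definition chromatic_number :: "'a graph \<Rightarrow> nat" where
  "chromatic_number G = (LEAST k. \<exists>c. proper_colouring G k c)"

text \<open>
  The functions \<open>f\<^sub>p(m)\<close> are specified for \<open>p \<ge> 2\<close> and \<open>m \<ge> 1\<close> by the four equations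
  proved below. The value at \<open>m = 0\<close> is set to \<open>0\<close>; it concerns only the graph without
  vertices. The value for \<open>p < 2\<close> is irrelevant.
\<close>

fun chi_bound :: "nat \<Rightarrow> nat \<Rightarrow> real" where
  "chi_bound p m =
     (if p < 2 \<or> m = 0 then 0
      else if m = 1 then 1
      else if p = 2 then 3 / 2 * real m
      else if m = 2 then 2 * real p - 2
      else real m + (\<Sum>j = 2..m. chi_bound (p - 1) j))"

declare chi_bound.simps [simp del]

lemma chi_bound_one: "p \<ge> 2 \<Longrightarrow> chi_bound p 1 = 1"
  by (simp add: chi_bound.simps)

lemma chi_bound_p2: "m \<ge> 2 \<Longrightarrow> chi_bound 2 m = 3 / 2 * real m"
  by (simp add: chi_bound.simps)

lemma chi_bound_two: "p \<ge> 3 \<Longrightarrow> chi_bound p 2 = 2 * real p - 2"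
  by (simp add: chi_bound.simps)

lemma chi_bound_rec:
  "p \<ge> 3 \<Longrightarrow> m \<ge> 3 \<Longrightarrow> chi_bound p m = real m + (\<Sum>j = 2..m. chi_bound (p - 1) j)"
  by (subst chi_bound.simps) simp

end

theory Submission
  imports Defs
begin

text \<open>
  \<^bold>\<open>Case \<open>p = 2\<close>.\<close> If the non-neighbours of a vertex of maximum degree are not stable, they yield an
  induced \<open>C\<^sub>5\<close>. A maximal blow-up of it is a homogeneous set: every other vertex is complete or
  anticomplete to it, the anticomplete ones are stable and reuse its colours, and at most two
  (consecutive) classes contain edges. Induction gives \<open>\<chi> \<le> 3\<omega>/2\<close>.

  \<^bold>\<open>Case \<open>p = 3\<close>, \<open>\<omega> = 2\<close>.\<close> For an edge \<open>pq\<close> the vertices adjacent to neither end are either bipartite,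
  giving four colours, or form a blow-up \<open>K\<^sub>0, \<dots>, K\<^sub>4\<close> of \<open>C\<^sub>5\<close> and a set \<open>I\<close> isolated from it. In the
  latter case one colour on \<open>N(q)\<close> and three on the rest suffice unless, for each \<open>i\<close>, some vertex of \<open>I\<close>
  with a neighbour in \<open>N(q)\<close> has a neighbour in \<open>N(p)\<close> that sees both \<open>K\<^bsub>i-1\<^esub>\<close> and \<open>K\<^bsub>i+1\<^esub>\<close>.
  If these obstructions are present for \<open>p\<close> and, with the roles exchanged, for \<open>q\<close>, they force an
  induced \<open>3K\<^sub>2\<close>.

  \<^bold>\<open>General case.\<close> For \<open>\<omega> = 2\<close> delete the neighbourhoods of the ends of an edge. For \<open>\<omega> \<ge> 3\<close> apply
  Wagon's argument to a maximum clique.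
\<close>

section \<open>Positivity and monotonicity of the bound functions\<close>

lemma chi_bound_zero: "chi_bound p 0 = 0"
  by (simp add: chi_bound.simps)

lemma chi_bound_nonneg: "0 \<le> chi_bound p m"
proof (induction p arbitrary: m)
  case 0
  show ?case by (simp add: chi_bound.simps)
next
  case (Suc p)
  show ?case
    by (subst chi_bound.simps) (auto intro!: add_nonneg_nonneg sum_nonneg Suc)
qed

text \<open>Monotonicity is wanted because colourings are built for the exact clique number of a
  set, while \<open>col_chi_bound\<close> accepts any upper bound on it. The delicate step leads
  from the closed value at 2 to the recursive value at 3.\<close>

lemma chi_bound_le_Suc:
  assumes "2 \<le> p"
  shows "chi_bound p m \<le> chi_bound p (Suc m)"
proof -
  consider "m = 0" | "m = 1" | "2 \<le> m" "p = 2" | "m = 2" "3 \<le> p" | "3 \<le> m" "3 \<le> p"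
    using assms by linarith
  then show ?thesis
  proof cases
    case 1
    then show ?thesis by (simp add: chi_bound_zero chi_bound_nonneg)
  next
    case 2
    then show ?thesis
      using assms chi_bound_p2[of 2] chi_bound_two[of p] chi_bound_one[of p]
      by (cases "p = 2") (simp_all add: numeral_2_eq_2[symmetric])
  next
    case 3
    then show ?thesis by (simp add: chi_bound_p2)
  next
    case 4
    \<comment> \<open>For \<open>p = 3\<close> the value is 3, otherwise equality holds. Together
      with the summand 3 this already exceeds \<open>2 * real p - 2\<close>.\<close>
    have "2 * real p - 4 \<le> chi_bound (p - 1) 2"
      using 4 chi_bound_p2[of 2] chi_bound_two[of "p - 1"] by (cases "p = 3") auto
    moreover have "{2..3::nat} = {2, 3}" by auto
    then have "chi_bound p 3 = 3 + (chi_bound (p - 1) 2 + chi_bound (p - 1) 3)"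
      using 4 chi_bound_rec[of p 3] by simp
    ultimately show ?thesis
      using 4 chi_bound_two[of p] chi_bound_nonneg[of "p - 1" 3] by (simp add: numeral_3_eq_3 numeral_2_eq_2)
  next
    case 5
    then show ?thesis
      using chi_bound_rec[of p m] chi_bound_rec[of p "Suc m"] chi_bound_nonneg[of "p - 1" "Suc m"] by simp
  qed
qed

lemma chi_bound_mono:
  assumes "2 \<le> p" "m \<le> n"
  shows "chi_bound p m \<le> chi_bound p n"
  using lift_Suc_mono_le[of "chi_bound p", OF chi_bound_le_Suc[OF assms(1)] assms(2)] .

section \<open>Colourings, cliques and induced matchings inside vertex sets\<close>

locale sgraph =
  fixes E :: "'a \<Rightarrow> 'a \<Rightarrow> bool"
  assumes E_sym: "E x y \<Longrightarrow> E y x"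
    and E_irrefl: "\<not> E x x"
begin

lemma E_comm: "E x y = E y x"
  using E_sym by blast

definition col :: "'a set \<Rightarrow> nat \<Rightarrow> bool" where
  "col S k \<longleftrightarrow> (\<exists>c. (\<forall>v\<in>S. c v < k) \<and> (\<forall>u\<in>S. \<forall>v\<in>S. E u v \<longrightarrow> c u \<noteq> c v))"

definition stable :: "'a set \<Rightarrow> bool" where
  "stable S \<longleftrightarrow> (\<forall>u\<in>S. \<forall>v\<in>S. \<not> E u v)"

definition complete_to :: "'a set \<Rightarrow> 'a set \<Rightarrow> bool" where
  "complete_to A B \<longleftrightarrow> (\<forall>a\<in>A. \<forall>b\<in>B. E a b)"

definition anti_to :: "'a set \<Rightarrow> 'a set \<Rightarrow> bool" where
  "anti_to A B \<longleftrightarrow> (\<forall>a\<in>A. \<forall>b\<in>B. \<not> E a b)"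

definition is_clique :: "'a set \<Rightarrow> bool" where
  "is_clique C \<longleftrightarrow> (\<forall>u\<in>C. \<forall>v\<in>C. u \<noteq> v \<longrightarrow> E u v)"

definition clique_bound :: "'a set \<Rightarrow> nat \<Rightarrow> bool" where
  "clique_bound S n \<longleftrightarrow> (\<forall>C\<subseteq>S. is_clique C \<longrightarrow> card C \<le> n)"

definition far :: "'a \<Rightarrow> 'a \<Rightarrow> 'a set \<Rightarrow> 'a set" where
  "far u v S = {x \<in> S. \<not> E u x \<and> \<not> E v x}"

text \<open>Peeling off one edge at a time suits the inductions on \<open>p\<close>. Adjacent
  \<open>u\<close> and \<open>v\<close> do not belong to \<open>far u v S\<close>, so the remaining
  edges are automatically disjoint from the removed one.\<close>

fun ind_matching :: "nat \<Rightarrow> 'a set \<Rightarrow> bool" where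
  "ind_matching 0 S = True"
| "ind_matching (Suc p) S = (\<exists>u\<in>S. \<exists>v\<in>S. E u v \<and> ind_matching p (far u v S))"

text \<open>A four-cycle \<open>a b c d\<close> with a roof \<open>e\<close> over the edge
  \<open>a b\<close>. The prescribed adjacencies and non-adjacencies force the five vertices to be
  distinct.\<close>

definition house_free :: "'a set \<Rightarrow> bool" where
  "house_free S \<longleftrightarrow> \<not> (\<exists>a\<in>S. \<exists>b\<in>S. \<exists>c\<in>S. \<exists>d\<in>S. \<exists>e\<in>S.
     E a b \<and> E b c \<and> E c d \<and> E d a \<and> \<not> E a c \<and> \<not> E b d \<and> E e a \<and> E e b \<and> \<not> E e c \<and> \<not> E e d)"

lemma house_freeD:
  assumes "house_free S" "{a, b, c, d, e} \<subseteq> S"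
    "E a b" "E b c" "E c d" "E d a" "\<not> E a c" "\<not> E b d" "E e a" "E e b" "\<not> E e c" "\<not> E e d"
  shows False
  using assms unfolding house_free_def by (meson insert_subset)

lemma house_free_mono: "house_free T \<Longrightarrow> S \<subseteq> T \<Longrightarrow> house_free S"
  unfolding house_free_def by blast

lemma far_mono: "S \<subseteq> T \<Longrightarrow> far u v S \<subseteq> far u v T"
  unfolding far_def by blast

lemma ind_matching_mono: "ind_matching p S \<Longrightarrow> S \<subseteq> T \<Longrightarrow> ind_matching p T"
proof (induction p arbitrary: S T)
  case (Suc p)
  then obtain u v where "u \<in> S" "v \<in> S" "E u v" "ind_matching p (far u v S)"
    by auto
  moreover from this have "ind_matching p (far u v T)"
    using Suc.IH far_mono[OF Suc.prems(2)] by blast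
  ultimately show ?case
    using Suc.prems(2) unfolding ind_matching.simps by (meson subsetD)
qed simp

lemma clique_bound_mono: "clique_bound T n \<Longrightarrow> S \<subseteq> T \<Longrightarrow> clique_bound S n"
  unfolding clique_bound_def using subset_trans by metis

lemma max_clique_exists:
  assumes "finite S"
  obtains C where "C \<subseteq> S" "is_clique C" "clique_bound S (card C)"
proof -
  let ?F = "{C. C \<subseteq> S \<and> is_clique C}"
  have "finite ?F" "?F \<noteq> {}"
    using assms by (auto simp: is_clique_def)
  then have "Max (card ` ?F) \<in> card ` ?F"
    by (intro Max_in) auto
  then obtain C where "C \<in> ?F" "card C = Max (card ` ?F)"
    by (metis (no_types, lifting) imageE)
  with \<open>finite ?F\<close> have "C \<in> ?F" "\<forall>D\<in>?F. card D \<le> card C"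
    by auto
  with that show thesis
    unfolding clique_bound_def by blast
qed

lemma is_clique_Un:
  assumes "is_clique C" "is_clique D" "complete_to C D"
  shows "is_clique (C \<union> D)"
  using assms E_sym unfolding is_clique_def complete_to_def by blast

lemma clique_bound_complete:
  assumes "clique_bound (A \<union> B) n" "complete_to A B" "finite A" "finite B"
    "C \<subseteq> A" "is_clique C" "D \<subseteq> B" "is_clique D"
  shows "card C + card D \<le> n"
proof -
  have "C \<inter> D = {}"
    using assms E_irrefl unfolding complete_to_def by blast
  moreover have "is_clique (C \<union> D)"
    using assms by (intro is_clique_Un) (auto simp: complete_to_def)
  ultimately show ?thesis
    using assms unfolding clique_bound_def
    by (metis Un_mono card_Un_disjoint finite_subset)
qed

lemma col_mono: "col T k \<Longrightarrow> S \<subseteq> T \<Longrightarrow> k \<le> l \<Longrightarrow> col S l"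
  unfolding col_def by (elim exE, rule exI) (auto intro: less_le_trans)

lemma col_empty: "col {} k"
  unfolding col_def by blast

lemma col_stable: "stable S \<Longrightarrow> col S 1"
  unfolding col_def stable_def by (intro exI[of _ "\<lambda>_. 0"]) auto

lemma col_Un:
  assumes "col A a" "col B b"
  shows "col (A \<union> B) (a + b)"
proof -
  obtain f g where f: "\<forall>v\<in>A. f v < a" "\<forall>u\<in>A. \<forall>v\<in>A. E u v \<longrightarrow> f u \<noteq> f v"
    and g: "\<forall>v\<in>B. g v < b" "\<forall>u\<in>B. \<forall>v\<in>B. E u v \<longrightarrow> g u \<noteq> g v"
    using assms unfolding col_def by auto
  let ?c = "\<lambda>v. if v \<in> A then f v else a + g v"
  have "?c v < a + b" if "v \<in> A \<union> B" for v
    using that f(1) g(1) by (cases "v \<in> A") (simp_all add: trans_less_add1)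
  moreover have "?c u \<noteq> ?c v" if "u \<in> A \<union> B" "v \<in> A \<union> B" "E u v" for u v
  proof (cases "u \<in> A"; cases "v \<in> A")
    assume "u \<in> A" "v \<notin> A"
    then have "f u < a" using f(1) by blast
    with \<open>u \<in> A\<close> \<open>v \<notin> A\<close> show ?thesis by simp
  next
    assume "u \<notin> A" "v \<in> A"
    then have "f v < a" using f(1) by blast
    with \<open>u \<notin> A\<close> \<open>v \<in> A\<close> show ?thesis by simp
  qed (use that f(2) g(2) in simp_all)
  ultimately show ?thesis
    unfolding col_def by (intro exI[of _ ?c]) blast
qed

lemma col_UN:
  assumes "finite J" "\<And>j. j \<in> J \<Longrightarrow> col (C j) (k j)"
  shows "col (\<Union>j\<in>J. C j) (\<Sum>j\<in>J. k j)"
  using assms by (induction J rule: finite_induct) (auto simp: col_empty intro: col_Un)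

lemma col_UN_anti:
  assumes "\<And>i. i \<in> J \<Longrightarrow> col (C i) k"
    and anti: "\<And>i j. i \<in> J \<Longrightarrow> j \<in> J \<Longrightarrow> i \<noteq> j \<Longrightarrow> anti_to (C i) (C j)"
  shows "col (\<Union>i\<in>J. C i) k"
proof -
  have "\<forall>i. \<exists>c. i \<in> J \<longrightarrow> (\<forall>v\<in>C i. c v < k) \<and> (\<forall>u\<in>C i. \<forall>v\<in>C i. E u v \<longrightarrow> c u \<noteq> c v)"
    using assms(1) unfolding col_def by blast
  from choice[OF this] obtain f where f: "\<And>i. i \<in> J \<Longrightarrow> \<forall>v\<in>C i. f i v < k"
    "\<And>i. i \<in> J \<Longrightarrow> \<forall>u\<in>C i. \<forall>v\<in>C i. E u v \<longrightarrow> f i u \<noteq> f i v"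
    by blast
  \<comment> \<open>The sets may overlap, so each vertex is coloured within one chosen set
    containing it. Vertices assigned to different sets are non-adjacent by
    \<open>anti\<close>.\<close>
  define g where "g v = (SOME i. i \<in> J \<and> v \<in> C i)" for v
  have g: "g v \<in> J \<and> v \<in> C (g v)" if "v \<in> (\<Union>i\<in>J. C i)" for v
  proof -
    have "\<exists>i. i \<in> J \<and> v \<in> C i"
      using that by blast
    from someI_ex[OF this] show ?thesis
      unfolding g_def .
  qed
  have "f (g u) u \<noteq> f (g v) v" if "u \<in> (\<Union>i\<in>J. C i)" "v \<in> (\<Union>i\<in>J. C i)" "E u v" for u v
  proof (cases "g u = g v")
    case True
    then show ?thesis
      using f(2)[of "g u"] g[OF that(1)] g[OF that(2)] that(3) by simp
  next
    case False
    then show ?thesis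
      using anti[of "g u" "g v"] g[OF that(1)] g[OF that(2)] that(3) unfolding anti_to_def by blast
  qed
  moreover have "f (g v) v < k" if "v \<in> (\<Union>i\<in>J. C i)" for v
    using f(1) g[OF that] by simp
  ultimately show ?thesis
    unfolding col_def by (intro exI[of _ "\<lambda>v. f (g v) v"] conjI ballI impI)
qed

lemma ind_matching_2I:
  assumes "{a, b, c, d} \<subseteq> S" "E a b" "E c d" "\<not> E a c" "\<not> E a d" "\<not> E b c" "\<not> E b d"
  shows "ind_matching 2 S"
proof -
  have "{c, d} \<subseteq> far a b S"
    using assms by (auto simp: far_def)
  with assms(1-3) show ?thesis
    by (auto simp: numeral_2_eq_2)
qed

lemma ind_matching_3I:
  assumes "{a, b, c, d, e, f} \<subseteq> S" "E a b" "E c d" "E e f"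
    "\<not> E a c" "\<not> E a d" "\<not> E b c" "\<not> E b d" "\<not> E a e" "\<not> E a f" "\<not> E b e" "\<not> E b f"
    "\<not> E c e" "\<not> E c f" "\<not> E d e" "\<not> E d f"
  shows "ind_matching 3 S"
proof -
  have "ind_matching 2 (far a b S)"
    by (rule ind_matching_2I[of c d e f]) (use assms in \<open>auto simp: far_def\<close>)
  then have "ind_matching (Suc 2) S"
    using assms(1,2) unfolding ind_matching.simps by blast
  then show ?thesis
    by (simp del: ind_matching.simps)
qed

section \<open>Blow-ups of the five-cycle\<close>

definition cyc5 :: "'a \<Rightarrow> 'a \<Rightarrow> 'a \<Rightarrow> 'a \<Rightarrow> 'a \<Rightarrow> bool" where
  "cyc5 a b c d e \<longleftrightarrow> E a b \<and> E b c \<and> E c d \<and> E d e \<and> E e a \<and>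
     \<not> E a c \<and> \<not> E b d \<and> \<not> E c e \<and> \<not> E d a \<and> \<not> E e b"

lemma cyc5_rot: "cyc5 a b c d e \<Longrightarrow> cyc5 b c d e a"
  unfolding cyc5_def using E_sym by blast

text \<open>On an induced five-cycle \<open>a b c d e\<close>, the vertex \<open>x\<close> behaves
  like \<open>b\<close>. Its adjacency to \<open>b\<close> itself is left open, since a class of a
  blow-up may contain edges.\<close>

definition twin5 :: "'a \<Rightarrow> 'a \<Rightarrow> 'a \<Rightarrow> 'a \<Rightarrow> 'a \<Rightarrow> bool" where
  "twin5 x a c d e \<longleftrightarrow> E x a \<and> E x c \<and> \<not> E x d \<and> \<not> E x e"

text \<open>The edge \<open>c d\<close> lies opposite to \<open>a\<close>; if \<open>x\<close>
  missed both of its ends, \<open>x a\<close> and \<open>c d\<close> would induce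
  \<open>2K_2\<close>.\<close>

lemma cyc5_neighbours_opposite:
  assumes free: "\<not> ind_matching 2 S"
    and S: "{a, b, c, d, e, x} \<subseteq> S" and c5: "cyc5 a b c d e" and xa: "E x a"
  shows "E x c \<or> E x d"
proof (rule ccontr)
  assume "\<not> ?thesis"
  then have "ind_matching 2 S"
    by (intro ind_matching_2I[of x a c d]) (use S c5[unfolded cyc5_def] xa E_sym in blast)+
  with free show False by blast
qed

text \<open>If \<open>x\<close> misses \<open>c\<close>, then the four-cycle \<open>b x d c\<close>
  with roof \<open>a\<close> is a house; if it misses \<open>e\<close>, the four-cycle
  \<open>a x d e\<close> with roof \<open>b\<close> is one.\<close>

lemma cyc5_neighbours_all:
  assumes free: "house_free S"
    and S: "{a, b, c, d, e, x} \<subseteq> S" and c5: "cyc5 a b c d e" and x: "E x a" "E x b" "E x d"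
  shows "E x c \<and> E x e"
proof (rule ccontr)
  note c = c5[unfolded cyc5_def]
  assume "\<not> ?thesis"
  then consider "\<not> E x c" | "\<not> E x e" by blast
  then show False
  proof cases
    case 1
    show False
      by (rule house_freeD[OF free, of b x d c a]) (use 1 S c x E_sym in blast)+
  next
    case 2
    show False
      by (rule house_freeD[OF free, of a x d e b]) (use 2 S c x E_sym in blast)+
  qed
qed

text \<open>The opposite-edge rule leaves three kinds of neighbourhood on the cycle: empty, a
  non-consecutive pair, or a set containing an edge and its opposite vertex. The last kind is forced
  to be the whole cycle.\<close>

lemma cyc5_neighbours:
  assumes free: "\<not> ind_matching 2 S" "house_free S"
    and S: "{a, b, c, d, e, x} \<subseteq> S" and c1: "cyc5 a b c d e"
  shows "(E x a \<and> E x b \<and> E x c \<and> E x d \<and> E x e) \<or>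
     (\<not> E x a \<and> \<not> E x b \<and> \<not> E x c \<and> \<not> E x d \<and> \<not> E x e) \<or>
     twin5 x a c d e \<or> twin5 x b d e a \<or> twin5 x c e a b \<or> twin5 x d a b c \<or> twin5 x e b c d"
proof -
  note c2 = cyc5_rot[OF c1]
  note c3 = cyc5_rot[OF c2]
  note c4 = cyc5_rot[OF c3]
  note c5 = cyc5_rot[OF c4]
  have S': "{b, c, d, e, a, x} \<subseteq> S" "{c, d, e, a, b, x} \<subseteq> S"
    "{d, e, a, b, c, x} \<subseteq> S" "{e, a, b, c, d, x} \<subseteq> S"
    using S by auto
  note o = cyc5_neighbours_opposite[OF free(1) S c1] cyc5_neighbours_opposite[OF free(1) S'(1) c2]
    cyc5_neighbours_opposite[OF free(1) S'(2) c3] cyc5_neighbours_opposite[OF free(1) S'(3) c4]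
    cyc5_neighbours_opposite[OF free(1) S'(4) c5]
  note l = cyc5_neighbours_all[OF free(2) S c1] cyc5_neighbours_all[OF free(2) S'(1) c2]
    cyc5_neighbours_all[OF free(2) S'(2) c3] cyc5_neighbours_all[OF free(2) S'(3) c4]
    cyc5_neighbours_all[OF free(2) S'(4) c5]
  show ?thesis
    unfolding twin5_def using o l by satx
qed

text \<open>Only adjacencies between different classes are prescribed; the classes themselves may
  carry edges. Disjointness follows, see \<open>blowup5_disjoint\<close>.\<close>

definition blowup5 :: "'a set \<Rightarrow> 'a set \<Rightarrow> 'a set \<Rightarrow> 'a set \<Rightarrow> 'a set \<Rightarrow> bool" where
  "blowup5 A B C D F \<longleftrightarrow>
     A \<noteq> {} \<and> B \<noteq> {} \<and> C \<noteq> {} \<and> D \<noteq> {} \<and> F \<noteq> {} \<and>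
     complete_to A B \<and> complete_to B C \<and> complete_to C D \<and> complete_to D F \<and> complete_to F A \<and>
     anti_to A C \<and> anti_to B D \<and> anti_to C F \<and> anti_to D A \<and> anti_to F B"

lemma complete_to_comm: "complete_to A B = complete_to B A"
  unfolding complete_to_def using E_sym by blast

lemma anti_to_comm: "anti_to A B = anti_to B A"
  unfolding anti_to_def using E_sym by blast

lemma blowup5_rot: "blowup5 A B C D F \<Longrightarrow> blowup5 B C D F A"
  unfolding blowup5_def by (simp add: anti_to_comm)

lemma blowup5_refl: "blowup5 A B C D F \<Longrightarrow> blowup5 A F D C B"
  unfolding blowup5_def by (simp add: anti_to_comm complete_to_comm)

lemma blowup5_cyc5:
  "blowup5 A B C D F \<Longrightarrow> a \<in> A \<Longrightarrow> b \<in> B \<Longrightarrow> c \<in> C \<Longrightarrow> d \<in> D \<Longrightarrow> e \<in> F \<Longrightarrow> cyc5 a b c d e"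
  unfolding blowup5_def cyc5_def complete_to_def anti_to_def by simp

text \<open>Exchange one cycle vertex at a time: on the new cycle the three unchanged adjacencies of
  \<open>x\<close> leave a single type, so \<open>x\<close> treats every vertex of a class like its
  representative.\<close>

lemma twin5_extends:
  assumes free: "\<not> ind_matching 2 S" "house_free S"
    and bl: "blowup5 A B C D F" and S: "A \<union> B \<union> C \<union> D \<union> F \<subseteq> S" "x \<in> S"
    and el: "a \<in> A" "b \<in> B" "c \<in> C" "d \<in> D" "e \<in> F" and tw: "twin5 x a c d e"
  shows "blowup5 A (insert x B) C D F"
proof -
  have ty: "(E x a' \<and> E x b \<and> E x c' \<and> E x d' \<and> E x e') \<or>
     (\<not> E x a' \<and> \<not> E x b \<and> \<not> E x c' \<and> \<not> E x d' \<and> \<not> E x e') \<or>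
     twin5 x a' c' d' e' \<or> twin5 x b d' e' a' \<or> twin5 x c' e' a' b \<or> twin5 x d' a' b c' \<or>
     twin5 x e' b c' d'"
    if "a' \<in> A" "c' \<in> C" "d' \<in> D" "e' \<in> F" for a' c' d' e'
    using that S el blowup5_cyc5[OF bl that(1) el(2) that(2-4)]
    by (intro cyc5_neighbours[OF free]) auto
  have "E x a'" if "a' \<in> A" for a'
    using ty[OF that el(3-5)] tw unfolding twin5_def by satx
  moreover have "E x c'" if "c' \<in> C" for c'
    using ty[OF el(1) that el(4,5)] tw unfolding twin5_def by satx
  moreover have "\<not> E x d'" if "d' \<in> D" for d'
    using ty[OF el(1,3) that el(5)] tw unfolding twin5_def by satx
  moreover have "\<not> E x e'" if "e' \<in> F" for e'
    using ty[OF el(1,3,4) that] tw unfolding twin5_def by satx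
  ultimately have "complete_to A {x}" "complete_to {x} C" "anti_to {x} D" "anti_to F {x}"
    using E_sym unfolding complete_to_def anti_to_def by blast+
  then show ?thesis
    using bl unfolding blowup5_def complete_to_def anti_to_def by simp
qed

text \<open>In a blow-up with the most vertices no outside vertex has twin type, as
  \<open>twin5_extends\<close> would add it to a class. The all-or-nothing types remain.\<close>

lemma max_blowup5_exists:
  assumes fin: "finite S" and free: "\<not> ind_matching 2 S" "house_free S"
    and c5: "cyc5 a b c d e" and el: "{a, b, c, d, e} \<subseteq> S"
  obtains A B C D F where "blowup5 A B C D F" "A \<union> B \<union> C \<union> D \<union> F \<subseteq> S"
    "\<forall>x\<in>S - (A \<union> B \<union> C \<union> D \<union> F).
       complete_to {x} (A \<union> B \<union> C \<union> D \<union> F) \<or> anti_to {x} (A \<union> B \<union> C \<union> D \<union> F)"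
proof -
  define P where "P n \<longleftrightarrow> (\<exists>A B C D F. blowup5 A B C D F \<and> A \<union> B \<union> C \<union> D \<union> F \<subseteq> S \<and>
      card (A \<union> B \<union> C \<union> D \<union> F) = n)" for n
  have "blowup5 {a} {b} {c} {d} {e}"
    using c5 unfolding blowup5_def cyc5_def complete_to_def anti_to_def by blast
  then have "\<exists>n. P n"
    unfolding P_def using el by (intro exI conjI) auto
  moreover have bnd: "\<And>n. P n \<Longrightarrow> n \<le> card S"
    unfolding P_def using fin card_mono by blast
  ultimately have PG: "P (Greatest P)"
    using GreatestI_nat[of P _ "card S"] by blast
  have Gr: "n \<le> Greatest P" if "P n" for n
    using Greatest_le_nat[of P n "card S"] that bnd by blast
  obtain A B C D F where bl: "blowup5 A B C D F" and S: "A \<union> B \<union> C \<union> D \<union> F \<subseteq> S"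
    and card: "card (A \<union> B \<union> C \<union> D \<union> F) = Greatest P"
    using PG unfolding P_def by blast
  show thesis
  proof (rule that[OF bl S], rule ballI)
    fix x assume "x \<in> S - (A \<union> B \<union> C \<union> D \<union> F)"
    then have x: "x \<in> S" "x \<notin> A \<union> B \<union> C \<union> D \<union> F" by blast+
    have no: False if "blowup5 A' B' C' D' F'"
      "A' \<union> B' \<union> C' \<union> D' \<union> F' = insert x (A \<union> B \<union> C \<union> D \<union> F)" for A' B' C' D' F'
    proof -
      have "card (insert x (A \<union> B \<union> C \<union> D \<union> F)) = Suc (Greatest P)"
        using x(2) card finite_subset[OF S fin] by simp
      then have "P (Suc (Greatest P))"
        unfolding P_def
        by (intro exI[of _ A'] exI[of _ B'] exI[of _ C'] exI[of _ D'] exI[of _ F'])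
          (use that S x(1) in simp)
      with Gr show False by fastforce
    qed
    note b2 = blowup5_rot[OF bl]
    note b3 = blowup5_rot[OF b2]
    note b4 = blowup5_rot[OF b3]
    note b5 = blowup5_rot[OF b4]
    have ty: "(E x a \<and> E x b \<and> E x c \<and> E x d \<and> E x e) \<or>
       (\<not> E x a \<and> \<not> E x b \<and> \<not> E x c \<and> \<not> E x d \<and> \<not> E x e)"
      if el: "a \<in> A" "b \<in> B" "c \<in> C" "d \<in> D" "e \<in> F" for a b c d e
    proof -
      have "\<not> twin5 x a c d e"
        using twin5_extends[OF free bl _ x(1) el] no[of A "insert x B" C D F] S by auto
      moreover have "\<not> twin5 x b d e a"
        using twin5_extends[OF free b2 _ x(1) el(2-5,1)] no[of B "insert x C" D F A] S by auto
      moreover have "\<not> twin5 x c e a b"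
        using twin5_extends[OF free b3 _ x(1) el(3-5,1,2)] no[of C "insert x D" F A B] S by auto
      moreover have "\<not> twin5 x d a b c"
        using twin5_extends[OF free b4 _ x(1) el(4,5,1-3)] no[of D "insert x F" A B C] S by auto
      moreover have "\<not> twin5 x e b c d"
        using twin5_extends[OF free b5 _ x(1) el(5,1-4)] no[of F "insert x A" B C D] S by auto
      ultimately show ?thesis
        using cyc5_neighbours[OF free, of a b c d e x] blowup5_cyc5[OF bl el] el S x(1) by blast
    qed
    obtain a b c d e where el: "a \<in> A" "b \<in> B" "c \<in> C" "d \<in> D" "e \<in> F"
      using bl unfolding blowup5_def by blast
    \<comment> \<open>Each choice of representatives is met entirely or not at all; varying one
      representative at a time compares every \<open>y\<close> with the fixed
      \<open>a\<close>.\<close>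
    have "E x y \<longleftrightarrow> E x a" if "y \<in> A \<union> B \<union> C \<union> D \<union> F" for y
      using that ty[OF _ el(2-5), of y] ty[OF el(1) _ el(3-5), of y] ty[OF el(1,2) _ el(4,5), of y]
        ty[OF el(1-3) _ el(5), of y] ty[OF el(1-4), of y] ty[OF el] by blast
    then show "complete_to {x} (A \<union> B \<union> C \<union> D \<union> F) \<or> anti_to {x} (A \<union> B \<union> C \<union> D \<union> F)"
      unfolding complete_to_def anti_to_def by blast
  qed
qed

text \<open>Let \<open>x y\<close> be an edge among the non-neighbours of \<open>v\<close>. By
  maximality of the degree, \<open>x\<close> misses some neighbour \<open>w\<close> of
  \<open>v\<close>, and \<open>y\<close> some \<open>w'\<close>: otherwise \<open>x\<close> would
  see all neighbours of \<open>v\<close> and also \<open>y\<close>, and likewise for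
  \<open>y\<close>. Then \<open>w y\<close> and \<open>w' x\<close> are edges because of
  \<open>2K_2\<close>, and \<open>w w'\<close> is not one because of the house with roof
  \<open>v\<close>.\<close>

lemma max_degree_cyc5:
  assumes fin: "finite S" and free: "\<not> ind_matching 2 S" "house_free S"
    and v: "v \<in> S" and max: "\<And>u. u \<in> S \<Longrightarrow> card {x \<in> S. E u x} \<le> card {x \<in> S. E v x}"
    and ns: "\<not> stable {x \<in> S. \<not> E v x}"
  obtains a b c d e where "cyc5 a b c d e" "{a, b, c, d, e} \<subseteq> S"
proof -
  obtain x y where xy: "x \<in> S" "y \<in> S" "E x y" "\<not> E v x" "\<not> E v y"
    using ns unfolding stable_def by blast
  have priv: "\<exists>w\<in>S. E v w \<and> \<not> E s w" if "s \<in> S" "t \<in> S" "E s t" "\<not> E v t" for s t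
  proof (rule ccontr)
    assume "\<not> ?thesis"
    then have "insert t {x \<in> S. E v x} \<subseteq> {x \<in> S. E s x}"
      using that by blast
    then have "card (insert t {x \<in> S. E v x}) \<le> card {x \<in> S. E s x}"
      using fin by (intro card_mono) auto
    moreover have "card (insert t {x \<in> S. E v x}) = Suc (card {x \<in> S. E v x})"
      using fin that(4) by (intro card_insert_disjoint) auto
    ultimately show False
      using max[OF that(1)] by simp
  qed
  obtain w where w: "w \<in> S" "E v w" "\<not> E x w"
    using priv[OF xy(1-3,5)] by blast
  obtain w' where w': "w' \<in> S" "E v w'" "\<not> E y w'"
    using priv[OF xy(2,1) E_sym[OF xy(3)] xy(4)] by blast
  have "E w y"
  proof (rule ccontr)
    assume "\<not> E w y"
    then have "ind_matching 2 S"
      by (intro ind_matching_2I[of v w x y]) (use v xy w E_sym in blast)+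
    with free(1) show False by blast
  qed
  have "E w' x"
  proof (rule ccontr)
    assume "\<not> E w' x"
    then have "ind_matching 2 S"
      by (intro ind_matching_2I[of v w' x y]) (use v xy w' E_sym in blast)+
    with free(1) show False by blast
  qed
  have "\<not> E w w'"
  proof
    assume "E w w'"
    show False
      by (rule house_freeD[OF free(2), of w w' x y v])
        (use \<open>E w w'\<close> \<open>E w y\<close> \<open>E w' x\<close> v xy w w' E_sym in blast)+
  qed
  have "cyc5 v w y x w'"
    unfolding cyc5_def
    using \<open>\<not> E w w'\<close> \<open>E w y\<close> \<open>E w' x\<close> xy w w' E_sym by blast
  then show thesis
    by (rule that) (use v xy w w' in blast)
qed

lemma col_insert_nonneighbours:
  assumes "col {x \<in> S. E v x} k" "stable {x \<in> S. \<not> E v x}"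
  shows "col S (Suc k)"
proof -
  have "col ({x \<in> S. E v x} \<union> {x \<in> S. \<not> E v x}) (k + 1)"
    using assms by (intro col_Un col_stable)
  then show ?thesis
    by (rule col_mono) auto
qed

section \<open>Colouring blow-ups and the case \<open>p = 2\<close>\<close>

lemma stable_Un: "stable A \<Longrightarrow> stable B \<Longrightarrow> anti_to A B \<Longrightarrow> stable (A \<union> B)"
  unfolding stable_def anti_to_def using E_comm by (metis Un_iff)

text \<open>A vertex of \<open>D\<close> separates \<open>A\<close> from \<open>C\<close>, being
  anticomplete to the one and complete to the other; a common vertex of \<open>A\<close> and
  \<open>B\<close> would be adjacent to itself.\<close>

lemma blowup5_disjoint:
  assumes "blowup5 A B C D F"
  shows "A \<inter> B = {}" "A \<inter> C = {}"
proof -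
  obtain d where "d \<in> D"
    using assms unfolding blowup5_def by blast
  have "E d a \<longleftrightarrow> False" if "a \<in> A" for a
    using assms that \<open>d \<in> D\<close> unfolding blowup5_def anti_to_def by simp
  moreover have "E c d" if "c \<in> C" for c
    using assms that \<open>d \<in> D\<close> unfolding blowup5_def complete_to_def by simp
  ultimately show "A \<inter> C = {}"
    using E_sym by blast
  show "A \<inter> B = {}"
    using assms E_irrefl unfolding blowup5_def complete_to_def by blast
qed

lemma col_blowup5_stable:
  assumes bl: "blowup5 A B C D F"
    and st: "stable A" "stable B" "stable C" "stable D" "stable F"
  shows "col (A \<union> B \<union> C \<union> D \<union> F) 3"
proof -
  have "stable (A \<union> C)" "stable (B \<union> D)"
    using bl st by (auto intro!: stable_Un simp: blowup5_def)
  then have "col ((A \<union> C) \<union> (B \<union> D) \<union> F) (1 + 1 + 1)"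
    using st by (intro col_Un col_stable)
  then show ?thesis
    by (rule col_mono) auto
qed

text \<open>The three stable classes reuse colours of \<open>A\<close> and \<open>B\<close>; this needs two colours on \<open>A\<close>.\<close>

lemma col_blowup5:
  assumes bl: "blowup5 A B C D F"
    and st: "stable C" "stable D" "stable F"
    and cA: "col A k" and cB: "col B l" and k: "2 \<le> k"
  shows "col (A \<union> B \<union> C \<union> D \<union> F) (k + l)"
proof -
  obtain f g where f: "\<forall>v\<in>A. f v < k" "\<forall>u\<in>A. \<forall>v\<in>A. E u v \<longrightarrow> f u \<noteq> f v"
    and g: "\<forall>v\<in>B. g v < l" "\<forall>u\<in>B. \<forall>v\<in>B. E u v \<longrightarrow> g u \<noteq> g v"
    using cA cB unfolding col_def by blast
  have ne: "B \<noteq> {}" "A \<noteq> {}" "C \<noteq> {}" "D \<noteq> {}" "F \<noteq> {}"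
    using bl unfolding blowup5_def by blast+
  then obtain b0 where "b0 \<in> B" by blast
  then have l: "0 < l" using g(1) by (metis not_less_zero gr_zeroI)
  \<comment> \<open>\<open>A\<close> receives the colours below \<open>k\<close> and
    \<open>B\<close> those from \<open>k\<close> on. \<open>C\<close> and \<open>D\<close> are
    anticomplete to \<open>A\<close> and take 0 and 1 from it; \<open>F\<close> is anticomplete to
    \<open>B\<close> and takes \<open>k\<close>.\<close>
  define c where "c v = (if v \<in> A then f v else if v \<in> B then k + g v else
    if v \<in> C then 0 else if v \<in> D then 1 else k)" for v
  note disj = blowup5_disjoint[OF bl] blowup5_disjoint[OF blowup5_rot[OF bl]]
    blowup5_disjoint[OF blowup5_rot[OF blowup5_rot[OF bl]]]
    blowup5_disjoint[OF blowup5_rot[OF blowup5_rot[OF blowup5_rot[OF bl]]]]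
    blowup5_disjoint[OF blowup5_rot[OF blowup5_rot[OF blowup5_rot[OF blowup5_rot[OF bl]]]]]
  have c: "\<And>v. v \<in> A \<Longrightarrow> c v = f v" "\<And>v. v \<in> B \<Longrightarrow> c v = k + g v"
    "\<And>v. v \<in> C \<Longrightarrow> c v = 0" "\<And>v. v \<in> D \<Longrightarrow> c v = 1" "\<And>v. v \<in> F \<Longrightarrow> c v = k"
    unfolding c_def using disj by auto
  have "c v < k + l" if "v \<in> A \<union> B \<union> C \<union> D \<union> F" for v
    using that
  proof (elim UnE)
    assume "v \<in> A"
    then show ?thesis using c(1) f(1) by (simp add: trans_less_add1)
  next
    assume "v \<in> B"
    then show ?thesis using c(2) g(1) by simp
  qed (use c(3-5) k l in simp_all)
  moreover have "c u \<noteq> c v" if "u \<in> A \<union> B \<union> C \<union> D \<union> F" "v \<in> A \<union> B \<union> C \<union> D \<union> F" "E u v" for u v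
  proof -
    have *: "\<not> E u v" if "u \<in> A \<and> v \<in> C \<or> u \<in> B \<and> v \<in> D \<or> u \<in> C \<and> v \<in> F \<or> u \<in> D \<and> v \<in> A
        \<or> u \<in> F \<and> v \<in> B \<or> u \<in> C \<and> v \<in> C \<or> u \<in> D \<and> v \<in> D \<or> u \<in> F \<and> v \<in> F" for u v
      using that bl st unfolding blowup5_def anti_to_def stable_def by (elim disjE conjE) simp_all
    have A: "c u < k" if "u \<in> A" for u
      using that f(1) c(1) by simp
    have B: "k \<le> c u" if "u \<in> B" for u
      using that c(2) by simp
    have "\<not> E v u \<Longrightarrow> False"
      using that(3) E_sym by blast
    with that *[of u v] *[of v u] consider "u \<in> A" "v \<in> A" | "u \<in> B" "v \<in> B"
      | "u \<in> A" "v \<in> B \<union> F" | "u \<in> B" "v \<in> A \<union> C" | "u \<in> C" "v \<in> B \<union> D" | "u \<in> D" "v \<in> C \<union> F"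
      | "u \<in> F" "v \<in> D \<union> A"
      by (elim UnE) simp_all
    then show ?thesis
    proof cases
      case 1
      then show ?thesis using c(1) f(2) that(3) by simp
    next
      case 2
      then show ?thesis using c(2) g(2) that(3) by simp
    next
      case 3
      then show ?thesis using A[of u] B[of v] c(5)[of v] by auto
    next
      case 4
      then show ?thesis using A[of v] B[of u] c(3)[of v] k by auto
    next
      case 5
      then show ?thesis using B[of v] c(3)[of u] c(4)[of v] k by auto
    next
      case 6
      then show ?thesis using c(3,5)[of v] c(4)[of u] k by auto
    next
      case 7
      then show ?thesis using A[of v] c(4)[of v] c(5)[of u] k by auto
    qed
  qed
  ultimately show ?thesis
    unfolding col_def by blast
qed

lemma col_Un_anti:
  assumes "col A k" "col B k" "anti_to A B"
  shows "col (A \<union> B) k"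
proof -
  have "col (\<Union>i\<in>UNIV. if i then A else B) k"
    by (rule col_UN_anti) (use assms anti_to_comm in auto)
  then show ?thesis
    by (rule col_mono) auto
qed

lemma col_ge_2: "col A k \<Longrightarrow> \<not> stable A \<Longrightarrow> 2 \<le> k"
proof (rule ccontr)
  assume "col A k" "\<not> stable A" "\<not> 2 \<le> k"
  then obtain c u v where "u \<in> A" "v \<in> A" "c u \<noteq> c v" "c u < k" "c v < (k::nat)"
    unfolding col_def stable_def by meson
  with \<open>\<not> 2 \<le> k\<close> show False by linarith
qed

text \<open>A witness clique replaces the clique number because witnesses combine: cliques of two
  mutually complete sets unite, and the sum of the rounded bounds is at most the rounded bound of
  the sum.\<close>

definition good_col :: "'a set \<Rightarrow> bool" where
  "good_col T \<longleftrightarrow> (\<exists>Q\<subseteq>T. is_clique Q \<and> col T (3 * card Q div 2))"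

lemma stable_if_anti_nonstable:
  assumes "\<not> ind_matching 2 S" "A \<union> B \<subseteq> S" "anti_to A B" "\<not> stable A"
  shows "stable B"
proof (rule ccontr)
  assume "\<not> stable B"
  then obtain x y where xy: "x \<in> B" "y \<in> B" "E x y"
    unfolding stable_def by blast
  obtain u v where uv: "u \<in> A" "v \<in> A" "E u v"
    using assms(4) unfolding stable_def by blast
  have "ind_matching 2 S"
    by (rule ind_matching_2I[of u v x y]) (use assms(2,3) xy uv in \<open>auto simp: anti_to_def\<close>)
  with assms(1) show False by blast
qed

text \<open>Being anticomplete to the non-stable \<open>A\<close>, the classes \<open>C\<close> and
  \<open>D\<close> are stable. The colours of \<open>A\<close> and \<open>B\<close> then suffice for
  everything, and the union of their witness cliques pays for them.\<close>

lemma good_col_blowup5_aux: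
  assumes free: "\<not> ind_matching 2 S" and fin: "finite S" and bl: "blowup5 A B C D F"
    and S: "A \<union> B \<union> C \<union> D \<union> F \<subseteq> S" and good: "good_col A" "good_col B"
    and ns: "\<not> stable A" and F: "stable F"
  shows "good_col (A \<union> B \<union> C \<union> D \<union> F)"
proof -
  have st: "stable C" "stable D"
    using stable_if_anti_nonstable[OF free _ _ ns] bl S by (auto simp: blowup5_def anti_to_comm)
  obtain P Q where P: "P \<subseteq> A" "is_clique P" "col A (3 * card P div 2)"
    and Q: "Q \<subseteq> B" "is_clique Q" "col B (3 * card Q div 2)"
    using good unfolding good_col_def by blast
  have "col (A \<union> B \<union> C \<union> D \<union> F) (3 * card P div 2 + 3 * card Q div 2)"
    using col_blowup5[OF bl st F P(3) Q(3)] col_ge_2[OF P(3) ns] by blast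
  moreover have "card (P \<union> Q) = card P + card Q"
    using P(1) Q(1) S fin blowup5_disjoint(1)[OF bl]
    by (intro card_Un_disjoint) (auto intro!: finite_subset[of _ S])
  moreover have "is_clique (P \<union> Q)"
    using P Q bl unfolding blowup5_def complete_to_def
    by (intro is_clique_Un) (auto simp: complete_to_def)
  ultimately show ?thesis
    unfolding good_col_def using P(1) Q(1)
    by (intro exI[of _ "P \<union> Q"]) (auto elim!: col_mono)
qed

lemma good_col_blowup5_nonstable:
  assumes free: "\<not> ind_matching 2 S" and fin: "finite S" and bl: "blowup5 A B C D F"
    and S: "A \<union> B \<union> C \<union> D \<union> F \<subseteq> S" and good: "good_col A" "good_col B" "good_col F"
    and ns: "\<not> stable A"
  shows "good_col (A \<union> B \<union> C \<union> D \<union> F)"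
proof (cases "stable F")
  case True
  with good_col_blowup5_aux[OF free fin bl S good(1,2) ns] show ?thesis by blast
next
  case False
  \<comment> \<open>\<open>B\<close> and \<open>F\<close> are anticomplete, so only one of them can
    contain an edge; a reflection fixing \<open>A\<close> exchanges their roles.\<close>
  then have "stable B"
    using stable_if_anti_nonstable[OF free, of F B] bl S by (auto simp: blowup5_def)
  moreover have "A \<union> F \<union> D \<union> C \<union> B = A \<union> B \<union> C \<union> D \<union> F" by auto
  ultimately show ?thesis
    using good_col_blowup5_aux[OF free fin blowup5_refl[OF bl] _ good(1,3) ns] S by simp
qed

lemma good_col_blowup5:
  assumes free: "\<not> ind_matching 2 S" and fin: "finite S" and bl: "blowup5 A B C D F"
    and S: "A \<union> B \<union> C \<union> D \<union> F \<subseteq> S"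
    and good: "good_col A" "good_col B" "good_col C" "good_col D" "good_col F"
  shows "good_col (A \<union> B \<union> C \<union> D \<union> F)"
proof -
  note b2 = blowup5_rot[OF bl]
  note b3 = blowup5_rot[OF b2]
  note b4 = blowup5_rot[OF b3]
  note b5 = blowup5_rot[OF b4]
  have eq: "B \<union> C \<union> D \<union> F \<union> A = A \<union> B \<union> C \<union> D \<union> F" "C \<union> D \<union> F \<union> A \<union> B = A \<union> B \<union> C \<union> D \<union> F"
    "D \<union> F \<union> A \<union> B \<union> C = A \<union> B \<union> C \<union> D \<union> F" "F \<union> A \<union> B \<union> C \<union> D = A \<union> B \<union> C \<union> D \<union> F"
    by auto
  consider "\<not> stable A" | "\<not> stable B" | "\<not> stable C" | "\<not> stable D" | "\<not> stable F"
    | "stable A" "stable B" "stable C" "stable D" "stable F"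
    by blast
  then show ?thesis
  proof cases
    case 1
    then show ?thesis using good_col_blowup5_nonstable[OF free fin bl S] good by simp
  next
    case 2
    then show ?thesis using good_col_blowup5_nonstable[OF free fin b2] S good by (simp add: eq)
  next
    case 3
    then show ?thesis using good_col_blowup5_nonstable[OF free fin b3] S good by (simp add: eq)
  next
    case 4
    then show ?thesis using good_col_blowup5_nonstable[OF free fin b4] S good by (simp add: eq)
  next
    case 5
    then show ?thesis using good_col_blowup5_nonstable[OF free fin b5] S good by (simp add: eq)
  next
    \<comment> \<open>With all classes stable three colours suffice, which is the bound for a
      witness clique consisting of one edge.\<close>
    case 6
    obtain a b where ab: "a \<in> A" "b \<in> B" "E a b"
      using bl unfolding blowup5_def complete_to_def by blast
    then have "a \<noteq> b" using E_irrefl by blast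
    then have "card {a, b} = 2" by simp
    moreover have "is_clique {a, b}"
      using ab E_sym unfolding is_clique_def by blast
    ultimately show ?thesis
      unfolding good_col_def using col_blowup5_stable[OF bl 6] ab
      by (intro exI[of _ "{a, b}"]) simp
  qed
qed

lemma max_degree_exists:
  assumes "finite S" "S \<noteq> {}"
  obtains v where "v \<in> S" "\<And>u. u \<in> S \<Longrightarrow> card {x \<in> S. E u x} \<le> card {x \<in> S. E v x}"
proof -
  let ?d = "\<lambda>u. card {x \<in> S. E u x}"
  have "Max (?d ` S) \<in> ?d ` S"
    using assms by (intro Max_in) auto
  then obtain v where "v \<in> S" "?d v = Max (?d ` S)"
    by (metis (no_types, lifting) imageE)
  moreover have "?d u \<le> Max (?d ` S)" if "u \<in> S" for u
    using assms that by (intro Max_ge) auto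
  ultimately show thesis
    using that by simp
qed

lemma good_col_2K2_house_free:
  assumes "finite S" "\<not> ind_matching 2 S" "house_free S"
  shows "good_col S"
  using assms
proof (induction "card S" arbitrary: S rule: less_induct)
  case less
  note fin = less.prems(1) and free = less.prems(2,3)
  have IH: "good_col T" if "T \<subset> S" for T
  proof -
    have "card T < card S" "finite T"
      using that fin psubset_card_mono finite_subset by blast+
    then show ?thesis
      using less.hyps[of T] that free ind_matching_mono house_free_mono by blast
  qed
  show ?case
  proof (cases "S = {}")
    case True
    then show ?thesis
      unfolding good_col_def is_clique_def by (simp add: col_empty)
  next
    case False
    then obtain v where v: "v \<in> S" "\<And>u. u \<in> S \<Longrightarrow> card {x \<in> S. E u x} \<le> card {x \<in> S. E v x}"
      using max_degree_exists[OF fin] by blast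
    show ?thesis
    proof (cases "stable {x \<in> S. \<not> E v x}")
      case True
      have "{x \<in> S. E v x} \<subset> S"
        using v(1) E_irrefl by blast
      from IH[OF this] obtain Q where Q: "Q \<subseteq> {x \<in> S. E v x}" "is_clique Q"
        "col {x \<in> S. E v x} (3 * card Q div 2)"
        unfolding good_col_def by blast
      \<comment> \<open>The extra colour is paid for by adding \<open>v\<close> to the clique, since
        the bound grows by at least one with each clique vertex.\<close>
      have "col S (Suc (3 * card Q div 2))"
        using col_insert_nonneighbours[OF Q(3) True] .
      moreover have "card (insert v Q) = Suc (card Q)"
        using Q(1) fin E_irrefl by (intro card_insert_disjoint) (auto intro!: finite_subset[of _ S])
      moreover have "is_clique (insert v Q)"
        using is_clique_Un[of "{v}" Q] Q(1,2) by (auto simp: complete_to_def is_clique_def[of "{v}"])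
      ultimately show ?thesis
        unfolding good_col_def using Q(1) v(1)
        by (intro exI[of _ "insert v Q"]) (auto elim!: col_mono)
    next
      case False
      obtain a b c d e where c5: "cyc5 a b c d e" "{a, b, c, d, e} \<subseteq> S"
        using max_degree_cyc5[OF fin free v False] .
      obtain A B C D F where bl: "blowup5 A B C D F" and sub: "A \<union> B \<union> C \<union> D \<union> F \<subseteq> S"
        and out: "\<forall>x\<in>S - (A \<union> B \<union> C \<union> D \<union> F).
          complete_to {x} (A \<union> B \<union> C \<union> D \<union> F) \<or> anti_to {x} (A \<union> B \<union> C \<union> D \<union> F)"
        using max_blowup5_exists[OF fin free c5] .
      define U where "U = A \<union> B \<union> C \<union> D \<union> F"
      \<comment> \<open>The vertices outside \<open>U\<close> split into \<open>K\<close> and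
        \<open>N\<close>. Cliques of \<open>U\<close> and \<open>K\<close> add up, while
        \<open>N\<close> is stable because \<open>U\<close> contains an edge.\<close>
      define K where "K = {x \<in> S - U. complete_to {x} U}"
      define N where "N = {x \<in> S - U. anti_to {x} U}"
      have ne: "A \<noteq> {}" "B \<noteq> {}" "C \<noteq> {}" "D \<noteq> {}" "F \<noteq> {}" and "complete_to A B"
        using bl unfolding blowup5_def by simp_all
      have "A \<subset> S" "B \<subset> S" "C \<subset> S" "D \<subset> S" "F \<subset> S"
        using sub blowup5_disjoint(1)[OF bl] blowup5_disjoint(1)[OF blowup5_rot[OF bl]]
          blowup5_disjoint(1)[OF blowup5_rot[OF blowup5_rot[OF bl]]]
          blowup5_disjoint(1)[OF blowup5_rot[OF blowup5_rot[OF blowup5_rot[OF bl]]]] ne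
        by blast+
      then have "good_col U"
        unfolding U_def by (intro good_col_blowup5[OF free(1) fin bl sub] IH)
      then obtain P where P: "P \<subseteq> U" "is_clique P" "col U (3 * card P div 2)"
        unfolding good_col_def by blast
      have "U \<noteq> {}" "U \<subseteq> S"
        using ne sub unfolding U_def by blast+
      have "\<not> stable U"
        using ne \<open>complete_to A B\<close> unfolding complete_to_def stable_def U_def by blast
      have "anti_to U N"
        unfolding N_def anti_to_def using E_sym by blast
      have "stable N"
        by (rule stable_if_anti_nonstable[OF free(1) _ \<open>anti_to U N\<close> \<open>\<not> stable U\<close>])
          (use \<open>U \<subseteq> S\<close> in \<open>auto simp: N_def\<close>)
      \<comment> \<open>\<open>U\<close> uses at least one colour, and that colour can be reused on
        \<open>N\<close>.\<close>
      have "1 \<le> 3 * card P div 2"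
        using col_ge_2[OF P(3) \<open>\<not> stable U\<close>] by simp
      then have "col (U \<union> N) (3 * card P div 2)"
        using col_Un_anti[OF P(3) _ \<open>anti_to U N\<close>] col_mono[OF col_stable[OF \<open>stable N\<close>]] by blast
      have "K \<subset> S"
        using \<open>U \<noteq> {}\<close> \<open>U \<subseteq> S\<close> unfolding K_def by blast
      from IH[OF this] obtain Q where Q: "Q \<subseteq> K" "is_clique Q" "col K (3 * card Q div 2)"
        unfolding good_col_def by blast
      have "S \<subseteq> (U \<union> N) \<union> K"
        using out unfolding K_def N_def U_def by blast
      then have "col S (3 * card P div 2 + 3 * card Q div 2)"
        using col_mono[OF col_Un[OF \<open>col (U \<union> N) _\<close> Q(3)]] by blast
      moreover have "card (P \<union> Q) = card P + card Q"
        using P(1) Q(1) fin \<open>U \<subseteq> S\<close>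
        by (intro card_Un_disjoint) (auto simp: K_def intro!: finite_subset[of _ S])
      moreover have "is_clique (P \<union> Q)"
        using P Q by (intro is_clique_Un) (auto simp: complete_to_def K_def intro: E_sym)
      ultimately show ?thesis
        unfolding good_col_def using P(1) Q(1) \<open>U \<subseteq> S\<close> \<open>K \<subset> S\<close>
        by (intro exI[of _ "P \<union> Q"]) (auto elim!: col_mono)
    qed
  qed
qed

section \<open>Triangle-free graphs without three independent edges\<close>

definition triangle_free :: "'a set \<Rightarrow> bool" where
  "triangle_free S \<longleftrightarrow> (\<forall>a\<in>S. \<forall>b\<in>S. \<forall>c\<in>S. \<not> (E a b \<and> E b c \<and> E a c))"

text \<open>This records the setting around an edge \<open>p q\<close> in a form invariant under
  rotation, reflection and exchange of \<open>p\<close> and \<open>q\<close>, so later lemmas treat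
  one index only. That the sets exhaust the common non-neighbours of \<open>p\<close> and
  \<open>q\<close> is a separate assumption, \<open>cover\<close> in
  \<open>col_conf\<close>.\<close>

definition conf :: "'a set \<Rightarrow> 'a \<Rightarrow> 'a \<Rightarrow> 'a set \<Rightarrow> 'a set \<Rightarrow> 'a set \<Rightarrow> 'a set \<Rightarrow> 'a set \<Rightarrow> 'a set \<Rightarrow> bool"
  where
  "conf S p q K0 K1 K2 K3 K4 I \<longleftrightarrow> \<not> ind_matching 3 S \<and> triangle_free S \<and> p \<in> S \<and> q \<in> S \<and> E p q \<and>
     K0 \<union> K1 \<union> K2 \<union> K3 \<union> K4 \<union> I \<subseteq> S \<and> blowup5 K0 K1 K2 K3 K4 \<and>
     anti_to {p, q} (K0 \<union> K1 \<union> K2 \<union> K3 \<union> K4 \<union> I) \<and> stable I \<and> anti_to I (K0 \<union> K1 \<union> K2 \<union> K3 \<union> K4)"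

text \<open>With \<open>M = K\<^bsub>i-1\<^esub>\<close> and \<open>N = K\<^bsub>i+1\<^esub>\<close>, the predicate \<open>hits\<close> singles out the neighbours of \<open>r\<close> that
  behave like \<open>K\<^sub>i\<close> towards the blow-up.\<close>

definition hits :: "'a set \<Rightarrow> 'a \<Rightarrow> 'a set \<Rightarrow> 'a set \<Rightarrow> 'a \<Rightarrow> bool" where
  "hits S r M N w \<longleftrightarrow> w \<in> S \<and> E r w \<and> (\<exists>k\<in>M. E w k) \<and> (\<exists>k\<in>N. E w k)"

text \<open>The symmetric form of the obstruction at one index: the same vertex of \<open>I\<close>
  serves both ends of the edge \<open>p q\<close>.\<close>

definition joined :: "'a set \<Rightarrow> 'a \<Rightarrow> 'a \<Rightarrow> 'a set \<Rightarrow> 'a set \<Rightarrow> 'a set \<Rightarrow> bool" where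
  "joined S p q M N I \<longleftrightarrow> (\<exists>z\<in>I. \<exists>w v. hits S p M N w \<and> hits S q M N v \<and> E z w \<and> E z v)"

lemma hits_comm: "hits S r M N w = hits S r N M w"
  unfolding hits_def by blast

lemma joined_comm: "joined S p q M N I = joined S p q N M I"
  unfolding joined_def using hits_comm by metis

lemma joined_swap: "joined S p q M N I = joined S q p M N I"
  unfolding joined_def by blast

lemma conf_rot: "conf S p q K0 K1 K2 K3 K4 I \<Longrightarrow> conf S p q K1 K2 K3 K4 K0 I"
  unfolding conf_def using blowup5_rot by (simp add: Un_ac)

lemma conf_refl: "conf S p q K0 K1 K2 K3 K4 I \<Longrightarrow> conf S p q K0 K4 K3 K2 K1 I"
  unfolding conf_def using blowup5_refl by (simp add: Un_ac)

lemma conf_swap: "conf S p q K0 K1 K2 K3 K4 I \<Longrightarrow> conf S q p K0 K1 K2 K3 K4 I"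
  unfolding conf_def using E_sym by (simp add: insert_commute)

lemma triangle_freeD:
  "triangle_free S \<Longrightarrow> a \<in> S \<Longrightarrow> b \<in> S \<Longrightarrow> c \<in> S \<Longrightarrow> E a b \<Longrightarrow> E b c \<Longrightarrow> \<not> E a c"
  unfolding triangle_free_def by blast

lemma conf_triangle:
  "conf S p q K0 K1 K2 K3 K4 I \<Longrightarrow> a \<in> S \<Longrightarrow> b \<in> S \<Longrightarrow> c \<in> S \<Longrightarrow> E a b \<Longrightarrow> E b c \<Longrightarrow> \<not> E a c"
  unfolding conf_def by (rule triangle_freeD) simp_all

lemma conf_no_matching:
  assumes "conf S p q K0 K1 K2 K3 K4 I" "{a, b, c, d, e, f} \<subseteq> S" "E a b" "E c d" "E e f"
    "\<not> E a c" "\<not> E a d" "\<not> E b c" "\<not> E b d" "\<not> E a e" "\<not> E a f" "\<not> E b e" "\<not> E b f"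
    "\<not> E c e" "\<not> E c f" "\<not> E d e" "\<not> E d f"
  shows False
  using ind_matching_3I[OF assms(2-)] assms(1) unfolding conf_def by blast

lemma conf_cyc5:
  "conf S p q K0 K1 K2 K3 K4 I \<Longrightarrow> k0 \<in> K0 \<Longrightarrow> k1 \<in> K1 \<Longrightarrow> k2 \<in> K2 \<Longrightarrow> k3 \<in> K3 \<Longrightarrow> k4 \<in> K4 \<Longrightarrow>
    cyc5 k0 k1 k2 k3 k4"
  unfolding conf_def using blowup5_cyc5 by blast

lemma conf_nonempty:
  assumes "conf S p q K0 K1 K2 K3 K4 I"
  obtains k0 k1 k2 k3 k4 where "k0 \<in> K0" "k1 \<in> K1" "k2 \<in> K2" "k3 \<in> K3" "k4 \<in> K4"
  using assms unfolding conf_def blowup5_def by auto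

lemma conf_base:
  assumes "conf S p q K0 K1 K2 K3 K4 I"
  shows "p \<in> S" "q \<in> S" "E p q"
    "\<And>k. k \<in> K0 \<union> K1 \<union> K2 \<union> K3 \<union> K4 \<union> I \<Longrightarrow> k \<in> S \<and> \<not> E p k \<and> \<not> E q k"
    "\<And>z k. z \<in> I \<Longrightarrow> k \<in> K0 \<union> K1 \<union> K2 \<union> K3 \<union> K4 \<Longrightarrow> \<not> E z k"
    "\<And>z z'. z \<in> I \<Longrightarrow> z' \<in> I \<Longrightarrow> \<not> E z z'"
  using assms unfolding conf_def anti_to_def stable_def by auto

lemma conf_other:
  assumes "conf S p q K0 K1 K2 K3 K4 I" "u \<in> S"
  shows "E q u \<Longrightarrow> \<not> E p u" "E p u \<Longrightarrow> \<not> E q u"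
  using conf_triangle[OF assms(1), of p q u] assms(2) conf_base(1-3)[OF assms(1)] E_sym by blast+

text \<open>Every vertex of \<open>K0\<close>, \<open>K2\<close> and \<open>K3\<close> is adjacent
  to all of \<open>K1\<close> or to all of \<open>K4\<close>, so a further neighbour of
  \<open>w\<close> there would close a triangle.\<close>

lemma hits_misses:
  assumes cf: "conf S p q K0 K1 K2 K3 K4 I" and w: "hits S r K4 K1 w"
  shows "k \<in> K0 \<union> K2 \<union> K3 \<Longrightarrow> \<not> E w k"
proof -
  assume k: "k \<in> K0 \<union> K2 \<union> K3"
  obtain k1 k4 where el: "k1 \<in> K1" "k4 \<in> K4" "E w k1" "E w k4" "w \<in> S"
    using w unfolding hits_def by blast
  have "E k1 k \<or> E k4 k"
    using k el(1,2) cf E_sym unfolding conf_def blowup5_def complete_to_def by (elim UnE) auto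
  moreover have "k \<in> S" "k1 \<in> S" "k4 \<in> S"
    using k el conf_base(4)[OF cf] by auto
  ultimately show "\<not> E w k"
    using conf_triangle[OF cf, of w k1 k] conf_triangle[OF cf, of w k4 k] el(3-5) by blast
qed

text \<open>Failure of the colouring in \<open>col_conf\<close> yields \<open>z\<close>,
  \<open>w\<close>, \<open>u\<close> for \<open>p\<close> and, with the ends exchanged,
  \<open>z'\<close> and \<open>v\<close> for \<open>q\<close>. Here these one-sided obstructions are
  merged into one with a common vertex of \<open>I\<close>.\<close>

lemma joined_exists:
  assumes cf: "conf S p q K0 K1 K2 K3 K4 I"
    and w: "hits S p K4 K1 w" and z: "z \<in> I" "E z w" and u: "u \<in> S" "E q u" "E z u"
    and v: "hits S q K4 K1 v" and z': "z' \<in> I" "E z' v"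
  shows "joined S p q K4 K1 I"
proof (rule ccontr)
  assume nj: "\<not> joined S p q K4 K1 I"
  have nzv: "\<not> E z v" and nzw: "\<not> E z' w"
    using nj w v z z' unfolding joined_def by blast+
  have wS: "w \<in> S" "E p w" and vS: "v \<in> S" "E q v"
    using w v unfolding hits_def by blast+
  obtain k1 k4 where wk: "k1 \<in> K1" "k4 \<in> K4" "E w k1" "E w k4"
    using w unfolding hits_def by blast
  obtain l1 l4 where vl: "l1 \<in> K1" "l4 \<in> K4" "E v l1" "E v l4"
    using v unfolding hits_def by blast
  obtain k0 k2 k3 where k: "k0 \<in> K0" "k2 \<in> K2" "k3 \<in> K3"
    using conf_nonempty[OF cf] by metis
  note cyc = conf_cyc5[OF cf k(1) wk(1) k(2,3) wk(2), unfolded cyc5_def]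
    conf_cyc5[OF cf k(1) wk(1) k(2,3) vl(2), unfolded cyc5_def]
    conf_cyc5[OF cf k(1) vl(1) k(2,3) wk(2), unfolded cyc5_def]
  have mem: "k0 \<in> S" "k1 \<in> S" "k2 \<in> S" "k3 \<in> S" "k4 \<in> S" "l1 \<in> S" "l4 \<in> S" "z \<in> S" "z' \<in> S" "p \<in> S" "q \<in> S"
    using conf_base[OF cf] k wk vl z z' by auto
  have pq: "\<not> E p k0" "\<not> E p k1" "\<not> E p k2" "\<not> E p k3" "\<not> E p k4" "\<not> E p l1" "\<not> E p l4" "\<not> E p z" "\<not> E p z'"
    "\<not> E q k0" "\<not> E q k1" "\<not> E q k2" "\<not> E q k3" "\<not> E q k4" "\<not> E q l1" "\<not> E q l4" "\<not> E q z" "\<not> E q z'"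
    using conf_base(4)[OF cf] k wk vl z z' by auto
  have zz: "\<not> E z k0" "\<not> E z k1" "\<not> E z k2" "\<not> E z k3" "\<not> E z k4" "\<not> E z l1" "\<not> E z l4" "\<not> E z z'"
    "\<not> E z' k0" "\<not> E z' k1" "\<not> E z' k2" "\<not> E z' k3" "\<not> E z' k4" "\<not> E z' l1" "\<not> E z' l4"
    using conf_base(5,6)[OF cf] k wk vl z z' by auto
  have wm: "\<not> E w k0" "\<not> E w k2" "\<not> E w k3" and vm: "\<not> E v k0" "\<not> E v k2" "\<not> E v k3"
    using hits_misses[OF cf w] hits_misses[OF cf v] k by auto
  have no: "\<not> E q w" "\<not> E p v" "\<not> E p u"
    using conf_other[OF cf] wS vS u by auto
  have nuw: "\<not> E u w" and nuv: "\<not> E u v"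
    using conf_triangle[OF cf, of u z w] conf_triangle[OF cf, of u q v] u z wS vS mem E_sym by blast+
  \<comment> \<open>Otherwise \<open>z w\<close>, \<open>q v\<close>, \<open>k2 k3\<close> form an
    induced matching.\<close>
  have wv: "E w v"
  proof (rule ccontr)
    assume "\<not> E w v"
    then show False
      by (intro conf_no_matching[OF cf, of z w q v k2 k3])
        (use mem wS vS z cyc pq zz wm vm no nzv E_sym in blast)+
  qed
  have nvk: "\<not> E v k1" "\<not> E v k4" and nwl: "\<not> E w l1" "\<not> E w l4"
    using conf_triangle[OF cf, of v w] conf_triangle[OF cf, of w v] wv E_sym[OF wv] wk vl mem wS vS
    by blast+
  \<comment> \<open>Otherwise \<open>q u\<close>, \<open>w k1\<close>, \<open>l4 k3\<close> form an
    induced matching; the mirrored claim uses \<open>q u\<close>, \<open>w k4\<close>,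
    \<open>l1 k2\<close>. As \<open>k2 k3\<close> is an edge, \<open>u\<close> cannot see both of
    its ends, so it sees a vertex of \<open>K1\<close> or \<open>K4\<close> and therefore misses
    \<open>k0\<close>.\<close>
  have "E u k1 \<or> E u l4 \<or> E u k3"
  proof (rule ccontr)
    assume "\<not> ?thesis"
    then show False
      by (intro conf_no_matching[OF cf, of q u w k1 l4 k3])
        (use mem u wS vS cyc pq zz wm no wk nwl nuw E_sym in blast)+
  qed
  moreover have "E u k4 \<or> E u l1 \<or> E u k2"
  proof (rule ccontr)
    assume "\<not> ?thesis"
    then show False
      by (intro conf_no_matching[OF cf, of q u w k4 l1 k2])
        (use mem u wS vS cyc pq zz wm no wk nwl nuw E_sym in blast)+
  qed
  ultimately have uk0: "\<not> E u k0"
    using conf_triangle[OF cf u(1), of k0 k1] conf_triangle[OF cf u(1), of k0 l1]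
      conf_triangle[OF cf u(1), of k0 k4] conf_triangle[OF cf u(1), of k0 l4]
      conf_triangle[OF cf u(1), of k2 k3] mem cyc E_sym by blast
  \<comment> \<open>If \<open>u\<close> were a hit, \<open>z\<close> would join \<open>w\<close> and
    \<open>u\<close>. Hence \<open>u\<close> misses \<open>K1\<close> or \<open>K4\<close> entirely,
    and edges from that class to \<open>k0\<close> serve as third edge of two matchings: the first
    forces \<open>z' u\<close>, the second then gives the contradiction.\<close>
  have "\<not> hits S q K4 K1 u"
    using nj w z u(3) unfolding joined_def by blast
  then consider "\<forall>k\<in>K1. \<not> E u k" | "\<forall>k\<in>K4. \<not> E u k"
    using u unfolding hits_def by blast
  then show False
  proof cases
    case 1
    then have uk: "\<not> E u k1" "\<not> E u l1"
      using wk vl by blast+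
    have "E z' u"
    proof (rule ccontr)
      assume "\<not> E z' u"
      then show False
        by (intro conf_no_matching[OF cf, of z u z' v k1 k0])
          (use mem u uk uk0 vS z z' cyc zz vm nvk nuv nzv E_sym in blast)+
    qed
    then show False
      by (intro conf_no_matching[OF cf, of z' u p w l1 k0])
        (use mem u uk uk0 wS z z' cyc zz wm pq no nwl nuw nzw E_sym in blast)+
  next
    case 2
    then have uk: "\<not> E u k4" "\<not> E u l4"
      using wk vl by blast+
    have "E z' u"
    proof (rule ccontr)
      assume "\<not> E z' u"
      then show False
        by (intro conf_no_matching[OF cf, of z u z' v k4 k0])
          (use mem u uk uk0 vS z z' cyc zz vm nvk nuv nzv E_sym in blast)+
    qed
    then show False
      by (intro conf_no_matching[OF cf, of z' u p w l4 k0])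
        (use mem u uk uk0 wS z z' cyc zz wm pq no nwl nuw nzw E_sym in blast)+
  qed
qed

text \<open>If \<open>v\<close> missed \<open>l\<close>, the edge \<open>l k3\<close> would be far
  from \<open>v\<close> and from the hits \<open>w'\<close>, \<open>v'\<close> at the neighbouring
  index. Successive matchings force the edges \<open>v w'\<close> and \<open>z v'\<close>, after
  which \<open>z v'\<close>, \<open>p w'\<close>, \<open>l k3\<close> is induced.\<close>

lemma joined_complete:
  assumes cf: "conf S p q K0 K1 K2 K3 K4 I"
    and z: "z \<in> I" "E z v" and v: "hits S q K4 K1 v" and j: "joined S p q K0 K2 I" and l: "l \<in> K4"
  shows "E v l"
proof (rule ccontr)
  assume nvl: "\<not> E v l"
  obtain z' w' v' where z': "z' \<in> I" "hits S p K0 K2 w'" "hits S q K0 K2 v'" "E z' w'" "E z' v'"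
    using j unfolding joined_def by blast
  have vS: "v \<in> S" "E q v" "w' \<in> S" "E p w'" "v' \<in> S" "E q v'"
    using v z' unfolding hits_def by blast+
  obtain k1 where k1: "k1 \<in> K1" "E v k1"
    using v unfolding hits_def by blast
  obtain k0 k2 k3 where k: "k0 \<in> K0" "k2 \<in> K2" "k3 \<in> K3"
    using conf_nonempty[OF cf] by metis
  note cyc = conf_cyc5[OF cf k(1) k1(1) k(2,3) l, unfolded cyc5_def]
  have mem: "k1 \<in> S" "k3 \<in> S" "l \<in> S" "z \<in> S" "z' \<in> S" "p \<in> S" "q \<in> S"
    using conf_base[OF cf] k k1 l z z' by auto
  have pq: "\<not> E p k1" "\<not> E p k3" "\<not> E p l" "\<not> E q k1" "\<not> E q k3" "\<not> E q l"
    "\<not> E p z" "\<not> E p z'" "\<not> E q z" "\<not> E q z'"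
    using conf_base(4)[OF cf] k k1 l z z' by auto
  have zz: "\<not> E z k1" "\<not> E z k3" "\<not> E z l" "\<not> E z z'" "\<not> E z' k1" "\<not> E z' k3" "\<not> E z' l"
    using conf_base(5,6)[OF cf] k k1 l z z' by auto
  have wm: "\<not> E v k3" "\<not> E w' k1" "\<not> E w' k3" "\<not> E w' l" "\<not> E v' k1" "\<not> E v' k3" "\<not> E v' l"
    using hits_misses[OF cf v] hits_misses[OF conf_rot[OF cf] z'(2)] hits_misses[OF conf_rot[OF cf] z'(3)]
      k k1 l by auto
  have no: "\<not> E q w'" "\<not> E p v" "\<not> E p v'"
    using conf_other[OF cf] vS by auto
  have nvv: "\<not> E v v'" "\<not> E w' v'"
    using conf_triangle[OF cf, of v q v'] conf_triangle[OF cf, of w' z' v'] vS z' mem E_sym by blast+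
  have vw: "E v w'"
  proof (rule ccontr)
    assume "\<not> E v w'"
    then show False
      by (intro conf_no_matching[OF cf, of p w' v k1 l k3])
        (use mem vS k1 cyc pq wm no nvl E_sym in blast)+
  qed
  have nz: "\<not> E z w'" "\<not> E z' v"
    using conf_triangle[OF cf, of z v w'] conf_triangle[OF cf, of z' w' v] vS z z' mem vw E_sym by blast+
  have "E z v'"
  proof (rule ccontr)
    assume "\<not> E z v'"
    then show False
      by (intro conf_no_matching[OF cf, of z v z' v' l k3])
        (use mem vS z z' cyc zz wm nvl nvv nz E_sym in blast)+
  qed
  then show False
    by (intro conf_no_matching[OF cf, of z v' p w' l k3])
      (use mem vS z z' cyc zz pq wm no nvv nz E_sym in blast)+
qed

text \<open>By the reflected \<open>joined_complete\<close>, \<open>v\<close> is complete to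
  \<open>K1\<close> and so misses \<open>w2\<close>, which has a neighbour there. If
  \<open>v\<close> also missed \<open>w1\<close>, then \<open>q v\<close>, \<open>k0 w1\<close>,
  \<open>k3 w2\<close> would be an induced matching.\<close>

lemma consecutive_adjacent:
  assumes cf: "conf S p q K0 K1 K2 K3 K4 I"
    and z: "z \<in> I" "E z v" and v: "hits S q K4 K1 v" and j: "joined S p q K0 K3 I"
    and w1: "hits S p K0 K2 w1" and w2: "hits S p K1 K3 w2"
  shows "E v w1"
proof (rule ccontr)
  assume nvw: "\<not> E v w1"
  obtain k0 where k0: "k0 \<in> K0" "E w1 k0" "w1 \<in> S" "E p w1"
    using w1 unfolding hits_def by blast
  obtain k1 k3 where k: "k1 \<in> K1" "k3 \<in> K3" "E w2 k1" "E w2 k3" "w2 \<in> S" "E p w2"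
    using w2 unfolding hits_def by blast
  have vS: "v \<in> S" "E q v"
    using v unfolding hits_def by blast+
  obtain k2 k4 where k24: "k2 \<in> K2" "k4 \<in> K4"
    using conf_nonempty[OF cf] by metis
  note cyc = conf_cyc5[OF cf k0(1) k(1) k24(1) k(2) k24(2), unfolded cyc5_def]
  have mem: "k0 \<in> S" "k1 \<in> S" "k3 \<in> S" "p \<in> S" "q \<in> S"
    and pq: "\<not> E q k0" "\<not> E q k3"
    using conf_base[OF cf] k k0 by auto
  have "E v k1"
    using joined_complete[OF conf_refl[OF cf] z _ j k(1)] v hits_comm by blast
  then have nvw2: "\<not> E v w2"
    using conf_triangle[OF cf, of v k1 w2] k vS mem E_sym by blast
  have wm: "\<not> E v k0" "\<not> E v k3" "\<not> E w1 k3" "\<not> E w2 k0"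
    using hits_misses[OF cf v] hits_misses[OF conf_rot[OF cf] w1]
      hits_misses[OF conf_rot[OF conf_rot[OF cf]] w2] k k0 by auto
  have no: "\<not> E q w1" "\<not> E q w2"
    using conf_other[OF cf] k k0 by auto
  have "\<not> E w1 w2"
    using conf_triangle[OF cf, of w1 p w2] k k0 mem E_sym by blast
  then show False
    by (intro conf_no_matching[OF cf, of q v k0 w1 k3 w2])
      (use mem k k0 vS nvw nvw2 wm no cyc pq E_sym in blast)+
qed

text \<open>Since \<open>v w1\<close> is an edge, \<open>z\<close> misses \<open>w1\<close>. If
  \<open>z\<close> also missed \<open>w2\<close>, then \<open>z w\<close>, \<open>w2 k3\<close>,
  \<open>k0 w1\<close> would be an induced matching.\<close>

lemma second_adjacent:
  assumes cf: "conf S p q K0 K1 K2 K3 K4 I"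
    and z: "z \<in> I" "E z v" "E z w" and v: "hits S q K4 K1 v" and w: "hits S p K4 K1 w"
    and j: "joined S p q K0 K3 I"
    and w1: "hits S p K0 K2 w1" and w2: "hits S p K1 K3 w2"
  shows "E z w2"
proof (rule ccontr)
  assume nzw: "\<not> E z w2"
  obtain k0 where k0: "k0 \<in> K0" "E w1 k0" "w1 \<in> S" "E p w1"
    using w1 unfolding hits_def by blast
  obtain k1 k3 where k: "k1 \<in> K1" "k3 \<in> K3" "E w2 k1" "E w2 k3" "w2 \<in> S" "E p w2"
    using w2 unfolding hits_def by blast
  have vS: "v \<in> S" "E q v" "w \<in> S" "E p w"
    using v w unfolding hits_def by blast+
  obtain k2 k4 where k24: "k2 \<in> K2" "k4 \<in> K4"
    using conf_nonempty[OF cf] by metis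
  note cyc = conf_cyc5[OF cf k0(1) k(1) k24(1) k(2) k24(2), unfolded cyc5_def]
  have mem: "k0 \<in> S" "k3 \<in> S" "p \<in> S" "z \<in> S"
    using conf_base[OF cf] k k0 z by auto
  have zk: "\<not> E z k0" "\<not> E z k3"
    using conf_base(5)[OF cf] z k k0 by auto
  have "E v w1"
    using consecutive_adjacent[OF cf z(1,2) v j w1 w2] .
  then have nzw1: "\<not> E z w1"
    using conf_triangle[OF cf, of z v w1] k0 z vS mem by blast
  have wm: "\<not> E w k0" "\<not> E w k3" "\<not> E w1 k3" "\<not> E w2 k0"
    using hits_misses[OF cf w] hits_misses[OF conf_rot[OF cf] w1]
      hits_misses[OF conf_rot[OF conf_rot[OF cf]] w2] k k0 by auto
  have no: "\<not> E w w1" "\<not> E w w2" "\<not> E w1 w2"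
    using conf_triangle[OF cf, of w p] conf_triangle[OF cf, of w1 p w2] vS k k0 mem E_sym by blast+
  show False
    by (rule conf_no_matching[OF cf, of z w w2 k3 k0 w1])
      (use mem k k0 vS nzw nzw1 z zk wm no cyc E_sym in blast)+
qed

text \<open>The vertex \<open>z\<close> joined at index 0 sees the \<open>q\<close>-side hit
  \<open>v2\<close> at index 2 and, by reflection, the \<open>p\<close>-side hit \<open>w3\<close>
  at index 3. Hits at consecutive indices on opposite sides are adjacent, so \<open>z\<close>,
  \<open>v2\<close>, \<open>w3\<close> is a triangle.\<close>

lemma not_all_joined:
  assumes cf: "conf S p q K0 K1 K2 K3 K4 I"
    and j: "joined S p q K4 K1 I" "joined S p q K0 K2 I" "joined S p q K1 K3 I" "joined S p q K2 K4 I"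
      "joined S p q K3 K0 I"
  shows False
proof -
  obtain z w v where z: "z \<in> I" "hits S p K4 K1 w" "hits S q K4 K1 v" "E z w" "E z v"
    using j(1) unfolding joined_def by blast
  obtain w1 v1 where w1: "hits S p K0 K2 w1" "hits S q K0 K2 v1"
    using j(2) unfolding joined_def by blast
  obtain z2 w2 v2 where z2: "z2 \<in> I" "hits S p K1 K3 w2" "hits S q K1 K3 v2" "E z2 w2" "E z2 v2"
    using j(3) unfolding joined_def by blast
  obtain w3 where w3: "hits S p K2 K4 w3"
    using j(4) unfolding joined_def by blast
  obtain w4 where w4: "hits S p K3 K0 w4"
    using j(5) unfolding joined_def by blast
  have "E z v2"
    by (rule second_adjacent[OF conf_swap[OF cf] z(1,4,5,2,3) _ w1(2) z2(3)])
      (use j(5) joined_comm joined_swap in blast)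
  moreover have "E z w3"
    by (rule second_adjacent[OF conf_refl[OF cf] z(1,5,4)])
      (use z w3 w4 j(2) joined_comm hits_comm in blast)+
  moreover have "E v2 w3"
    by (rule consecutive_adjacent[OF conf_rot[OF conf_rot[OF cf]] z2(1,5,3) _ w3 w4])
      (use j(2) joined_comm in blast)
  moreover have "z \<in> S" "v2 \<in> S" "w3 \<in> S"
    using z z2 w3 conf_base(4)[OF cf] unfolding hits_def by auto
  ultimately show False
    using conf_triangle[OF cf, of z v2 w3] by blast
qed

text \<open>The vertices of \<open>I\<close> with a neighbour in \<open>Q\<close> (the set
  \<open>J\<close>) cannot share its colour. They join \<open>K0\<close> and \<open>X\<close>, whose
  members behave like \<open>K0\<close> and miss \<open>J\<close> by \<open>free\<close>. The other
  neighbours of \<open>p\<close> are distributed over the colours of \<open>K2 \<union> K4\<close>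
  and \<open>K1 \<union> K3\<close>.\<close>

lemma col_conf:
  assumes cf: "conf S p q K0 K1 K2 K3 K4 I"
    and st: "stable K0" "stable K1" "stable K2" "stable K3" "stable K4"
    and cover: "\<And>x. x \<in> S \<Longrightarrow> x \<in> K0 \<union> K1 \<union> K2 \<union> K3 \<union> K4 \<union> I \<or> E p x \<or> E q x"
    and free: "\<And>w z u. hits S p K4 K1 w \<Longrightarrow> z \<in> I \<Longrightarrow> E z w \<Longrightarrow> u \<in> S \<Longrightarrow> E q u \<Longrightarrow> \<not> E z u"
  shows "col S 4"
proof -
  define P where "P = {x \<in> S. E p x}"
  define Q where "Q = {x \<in> S. E q x}"
  define J where "J = {z \<in> I. \<exists>u\<in>Q. E z u}"
  define X where "X = {w. hits S p K4 K1 w}"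
  define Y where "Y = {w \<in> P - X. \<forall>k\<in>K2 \<union> K4. \<not> E w k}"
  define Z where "Z = P - X - Y"
  note base = conf_base[OF cf]
  have tri: "\<not> (E a b \<and> E b c \<and> E a c)" if "a \<in> S" "b \<in> S" "c \<in> S" for a b c
    using conf_triangle[OF cf that] by blast
  have bl: "complete_to K0 K1" "complete_to K1 K2" "complete_to K2 K3" "complete_to K3 K4" "complete_to K4 K0"
    "anti_to K1 K3" "anti_to K2 K4"
    using cf unfolding conf_def blowup5_def by simp_all
  have "stable P" "stable Q"
    unfolding P_def Q_def stable_def using tri base(1,2) by blast+
  have sub: "X \<subseteq> P" "Y \<subseteq> P" "Z \<subseteq> P" "J \<subseteq> I"
    unfolding X_def Y_def Z_def J_def P_def hits_def by blast+
  have stP: "stable X" "stable Y" "stable Z"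
    using \<open>stable P\<close> sub unfolding stable_def by blast+
  have "stable (K0 \<union> J \<union> X)"
  proof (intro stable_Un st stP)
    show "stable J"
      using base(6) sub(4) unfolding stable_def by (meson subsetD)
    have "\<not> E k j" if "k \<in> K0" "j \<in> J" for j k
      using base(5)[of j k] that sub(4) E_sym[of k j] by auto
    then show "anti_to K0 J"
      unfolding anti_to_def by blast
    have "\<not> E j x" if jx: "j \<in> J" "x \<in> X" for j x
    proof
      assume "E j x"
      from jx(1) obtain u where "j \<in> I" "u \<in> S" "E q u" "E j u"
        unfolding J_def Q_def by blast
      with free[of x j u] \<open>E j x\<close> jx(2) show False
        unfolding X_def by simp
    qed
    moreover have "\<not> E k x" if "k \<in> K0" "x \<in> X" for k x
      using hits_misses[OF cf, of p x k] that E_sym[of k x] unfolding X_def by auto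
    ultimately show "anti_to (K0 \<union> J) X"
      unfolding anti_to_def by blast
  qed
  moreover have "stable (Q \<union> (I - J))"
  proof (intro stable_Un \<open>stable Q\<close>)
    show "stable (I - J)"
      using base(6) unfolding stable_def by blast
    show "anti_to Q (I - J)"
      unfolding anti_to_def J_def using E_sym by blast
  qed
  moreover have "stable (K2 \<union> K4 \<union> Y)"
  proof (intro stable_Un st stP bl)
    show "anti_to (K2 \<union> K4) Y"
      unfolding anti_to_def Y_def using E_sym by blast
  qed
  moreover have "stable (K1 \<union> K3 \<union> Z)"
  proof (intro stable_Un st stP bl)
    \<comment> \<open>By definition \<open>w\<close> has a neighbour in
      \<open>K2 \<union> K4\<close>. Without triangles a further neighbour in
      \<open>K1 \<union> K3\<close> must be non-adjacent to it, which leaves only the pair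
      \<open>K4\<close>, \<open>K1\<close> and makes \<open>w\<close> a hit.\<close>
    have "\<not> E w k" if w: "w \<in> Z" and k: "k \<in> K1 \<union> K3" for w k
    proof
      assume wk: "E w k"
      obtain l where l: "l \<in> K2 \<union> K4" "E w l"
        using w unfolding Z_def Y_def by blast
      have wS: "w \<in> S" "E p w" "\<not> hits S p K4 K1 w"
        using w unfolding Z_def P_def X_def by blast+
      have "k \<in> S" "l \<in> S"
        using base(4) k l(1) by auto
      then have "\<not> E l k" "\<not> E k l"
        using tri[of w l k] wk l(2) wS(1) E_sym[of k l] by blast+
      with k l(1) bl(2,3,4) have "k \<in> K1" "l \<in> K4"
        unfolding complete_to_def by auto
      with wk l wS show False
        unfolding hits_def by blast
    qed
    then show "anti_to (K1 \<union> K3) Z"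
      unfolding anti_to_def using E_sym by blast
  qed
  ultimately have "col ((K0 \<union> J \<union> X) \<union> (Q \<union> (I - J)) \<union> (K2 \<union> K4 \<union> Y) \<union> (K1 \<union> K3 \<union> Z)) (1 + 1 + 1 + 1)"
    by (intro col_Un col_stable)
  moreover have "x \<in> (K0 \<union> J \<union> X) \<union> (Q \<union> (I - J)) \<union> (K2 \<union> K4 \<union> Y) \<union> (K1 \<union> K3 \<union> Z)" if "x \<in> S" for x
    using cover[OF that] that unfolding Z_def P_def Q_def by blast
  ultimately show ?thesis
    by (auto elim!: col_mono)
qed

section \<open>Four colours for triangle-free graphs without an induced \<open>3K_2\<close>\<close>

lemma triangle_free_house_free: "triangle_free S \<Longrightarrow> house_free S"
  unfolding triangle_free_def house_free_def using E_sym by meson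

lemma triangle_free_mono: "triangle_free T \<Longrightarrow> S \<subseteq> T \<Longrightarrow> triangle_free S"
  unfolding triangle_free_def by blast

lemma stable_neighbours: "triangle_free S \<Longrightarrow> v \<in> S \<Longrightarrow> stable {x \<in> S. E v x}"
  unfolding triangle_free_def stable_def by blast

text \<open>Neighbourhoods are stable, so two colours suffice if the non-neighbours of a vertex of
  maximum degree are stable too. Otherwise there is a maximal blow-up; a vertex complete to it would
  lie in a triangle, and the anticomplete ones are stable.\<close>

lemma triangle_free_2K2_free_cases:
  assumes fin: "finite S" and free: "\<not> ind_matching 2 S" and tf: "triangle_free S"
  obtains "col S 2" | A B C D F where "blowup5 A B C D F" "A \<union> B \<union> C \<union> D \<union> F \<subseteq> S"
    "stable (S - (A \<union> B \<union> C \<union> D \<union> F))" "anti_to (S - (A \<union> B \<union> C \<union> D \<union> F)) (A \<union> B \<union> C \<union> D \<union> F)"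
proof (cases "S = {}")
  case True
  then show thesis using that(1) col_empty by simp
next
  case False
  note hf = triangle_free_house_free[OF tf]
  obtain v where v: "v \<in> S" "\<And>u. u \<in> S \<Longrightarrow> card {x \<in> S. E u x} \<le> card {x \<in> S. E v x}"
    using max_degree_exists[OF fin False] by blast
  show thesis
  proof (cases "stable {x \<in> S. \<not> E v x}")
    case True
    from col_insert_nonneighbours[OF col_stable[OF stable_neighbours[OF tf v(1)]] True] that(1)
    show thesis by (simp add: numeral_2_eq_2)
  next
    case False
    obtain a b c d e where c5: "cyc5 a b c d e" "{a, b, c, d, e} \<subseteq> S"
      using max_degree_cyc5[OF fin free hf v False] .
    obtain A B C D F where bl: "blowup5 A B C D F" and sub: "A \<union> B \<union> C \<union> D \<union> F \<subseteq> S"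
      and out: "\<forall>x\<in>S - (A \<union> B \<union> C \<union> D \<union> F).
        complete_to {x} (A \<union> B \<union> C \<union> D \<union> F) \<or> anti_to {x} (A \<union> B \<union> C \<union> D \<union> F)"
      using max_blowup5_exists[OF fin free hf c5] .
    define U where "U = A \<union> B \<union> C \<union> D \<union> F"
    have "A \<noteq> {}" "B \<noteq> {}" "complete_to A B"
      using bl unfolding blowup5_def by simp_all
    then obtain a b where ab: "a \<in> U" "b \<in> U" "E a b"
      unfolding complete_to_def U_def by blast
    have "\<not> complete_to {x} U" if "x \<in> S - U" for x
    proof
      assume "complete_to {x} U"
      then have "E x a" "E x b"
        using ab unfolding complete_to_def by blast+
      with ab that sub show False
        using triangle_freeD[OF tf, of x a b] unfolding U_def by blast
    qed
    then have anti: "anti_to (S - U) U"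
      using out unfolding U_def[symmetric] anti_to_def by blast
    moreover have "\<not> stable U"
      using ab unfolding stable_def by blast
    ultimately have "stable (S - U)"
      using stable_if_anti_nonstable[OF free, of U "S - U"] sub unfolding U_def[symmetric]
      by (simp add: anti_to_comm)
    with anti that(2)[OF bl sub] show thesis
      unfolding U_def by blast
  qed
qed

lemma blowup5_stable:
  assumes "triangle_free S" "A \<union> B \<subseteq> S" "blowup5 A B C D F"
  shows "stable A"
proof -
  have "B \<noteq> {}" "complete_to A B"
    using assms(3) unfolding blowup5_def by simp_all
  then obtain b where b: "b \<in> B" "\<forall>a\<in>A. E a b"
    unfolding complete_to_def by blast
  show ?thesis
    unfolding stable_def
  proof (intro ballI)
    fix u v assume "u \<in> A" "v \<in> A"
    with b assms(2) have "u \<in> S" "v \<in> S" "b \<in> S" "E u b" "E v b"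
      by auto
    then show "\<not> E u v"
      using triangle_freeD[OF assms(1), of u b v] E_sym by blast
  qed
qed

lemma col_triangle_free_3K2_free:
  assumes fin: "finite S" and free: "\<not> ind_matching 3 S" and tf: "triangle_free S"
  shows "col S 4"
proof (cases "stable S")
  case True
  from col_mono[OF col_stable[OF this]] show ?thesis by simp
next
  case False
  then obtain p q where pq: "p \<in> S" "q \<in> S" "E p q"
    unfolding stable_def by blast
  define R where "R = far p q S"
  have R: "R \<subseteq> S" "finite R"
    unfolding R_def far_def using fin by auto
  have "\<not> ind_matching (Suc 2) S"
    using free by (simp del: ind_matching.simps)
  with pq have free2: "\<not> ind_matching 2 R"
    unfolding R_def ind_matching.simps by blast
  show ?thesis
  proof (rule triangle_free_2K2_free_cases[OF R(2) free2 triangle_free_mono[OF tf R(1)]])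
    assume "col R 2"
    then have "col ({x \<in> S. E p x} \<union> {x \<in> S. E q x} \<union> R) (1 + 1 + 2)"
      using pq tf by (intro col_Un col_stable stable_neighbours)
    then show ?thesis
      by (rule col_mono) (auto simp: R_def far_def)
  next
    fix K0 K1 K2 K3 K4
    assume bl: "blowup5 K0 K1 K2 K3 K4" and sub: "K0 \<union> K1 \<union> K2 \<union> K3 \<union> K4 \<subseteq> R"
      and I: "stable (R - (K0 \<union> K1 \<union> K2 \<union> K3 \<union> K4))"
        "anti_to (R - (K0 \<union> K1 \<union> K2 \<union> K3 \<union> K4)) (K0 \<union> K1 \<union> K2 \<union> K3 \<union> K4)"
    define I where "I = R - (K0 \<union> K1 \<union> K2 \<union> K3 \<union> K4)"
    have c0: "conf S p q K0 K1 K2 K3 K4 I"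
    proof -
      have "K0 \<union> K1 \<union> K2 \<union> K3 \<union> K4 \<union> I \<subseteq> R"
        using sub unfolding I_def by blast
      moreover from this have "anti_to {p, q} (K0 \<union> K1 \<union> K2 \<union> K3 \<union> K4 \<union> I)"
        unfolding anti_to_def R_def far_def by blast
      ultimately show ?thesis
        unfolding conf_def using free tf pq bl R(1) I[folded I_def] by (meson subset_trans)
    qed
    have sub': "K0 \<union> K1 \<union> K2 \<union> K3 \<union> K4 \<subseteq> S"
      using sub R(1) by blast
    note b1 = blowup5_rot[OF bl]
    note b2 = blowup5_rot[OF b1]
    note b3 = blowup5_rot[OF b2]
    note b4 = blowup5_rot[OF b3]
    note c1 = conf_rot[OF c0]
    note c2 = conf_rot[OF c1]
    note c3 = conf_rot[OF c2]
    note c4 = conf_rot[OF c3]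
    have st: "stable K0" "stable K1" "stable K2" "stable K3" "stable K4"
      using blowup5_stable[OF tf _ bl] blowup5_stable[OF tf _ b1] blowup5_stable[OF tf _ b2]
        blowup5_stable[OF tf _ b3] blowup5_stable[OF tf _ b4] sub' by auto
    have cover: "x \<in> K0 \<union> K1 \<union> K2 \<union> K3 \<union> K4 \<union> I \<or> E p x \<or> E q x" if "x \<in> S" for x
      using that unfolding I_def R_def far_def by blast
    have cover_swap: "x \<in> K0 \<union> K1 \<union> K2 \<union> K3 \<union> K4 \<union> I \<or> E q x \<or> E p x" if "x \<in> S" for x
      using cover[OF that] by blast
    show ?thesis
    proof (rule ccontr)
      assume nc: "\<not> col S 4"
      \<comment> \<open>If four colours fail, \<open>col_conf\<close> is blocked for both orders of
        \<open>p\<close> and \<open>q\<close>, which supplies the hypotheses of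
        \<open>joined_exists\<close>. Arbitrary \<open>L0\<close>, ..., \<open>L4\<close> allow the
        use for all five rotations.\<close>
      have j: "joined S p q L4 L1 I"
        if cf: "conf S p q L0 L1 L2 L3 L4 I"
          and stL: "stable L0" "stable L1" "stable L2" "stable L3" "stable L4"
          and eq: "L0 \<union> L1 \<union> L2 \<union> L3 \<union> L4 = K0 \<union> K1 \<union> K2 \<union> K3 \<union> K4" for L0 L1 L2 L3 L4
      proof -
        have "\<exists>w z u. hits S p L4 L1 w \<and> z \<in> I \<and> E z w \<and> u \<in> S \<and> E q u \<and> E z u"
          using col_conf[OF cf stL, unfolded eq, OF cover] nc by blast
        moreover have "\<exists>w z. hits S q L4 L1 w \<and> z \<in> I \<and> E z w"
          using col_conf[OF conf_swap[OF cf] stL, unfolded eq, OF cover_swap] nc by blast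
        ultimately show ?thesis
          using joined_exists[OF cf] by blast
      qed
      show False
        using not_all_joined[OF c0 j[OF c0 st] j[OF c1 st(2-5,1)] j[OF c2 st(3-5,1,2)]
          j[OF c3 st(4,5,1-3)] j[OF c4 st(5,1-4)]] by (simp add: Un_ac)
    qed
  qed
qed

section \<open>The general bound\<close>

lemma not_ind_matching_far:
  "\<not> ind_matching (Suc p) S \<Longrightarrow> u \<in> S \<Longrightarrow> v \<in> S \<Longrightarrow> E u v \<Longrightarrow> \<not> ind_matching p (far u v S)"
  by auto

lemma col_triangle_free:
  assumes "3 \<le> p" "finite S" "\<not> ind_matching p S" "triangle_free S"
  shows "col S (2 * p - 2)"
  using assms
proof (induction p arbitrary: S rule: dec_induct)
  case base
  then show ?case
    using col_triangle_free_3K2_free by simp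
next
  case (step p)
  show ?case
  proof (cases "stable S")
    case True
    then show ?thesis
      using step.hyps by (intro col_mono[OF col_stable]) auto
  next
    case False
    then obtain u v where uv: "u \<in> S" "v \<in> S" "E u v"
      unfolding stable_def by blast
    have sub: "far u v S \<subseteq> S"
      unfolding far_def by blast
    have "col (far u v S) (2 * p - 2)"
      using not_ind_matching_far[OF step.prems(2) uv] step.prems(1,3) sub
      by (intro step.IH) (auto intro: finite_subset triangle_free_mono)
    then have "col ({x \<in> S. E u x} \<union> {x \<in> S. E v x} \<union> far u v S) (1 + 1 + (2 * p - 2))"
      using uv step.prems(3) by (intro col_Un col_stable stable_neighbours)
    then show ?thesis
      by (rule col_mono) (use step.hyps in \<open>auto simp: far_def\<close>)
  qed
qed

text \<open>Wagon's argument: vertices are sorted by the first two members of a maximum clique that they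
  miss. House-freeness makes the classes with the same second missed vertex pairwise anticomplete,
  so they can share colours.\<close>

lemma col_wagon:
  assumes fin: "finite S" and hf: "house_free S" and free: "\<not> ind_matching (Suc p) S"
    and C: "C \<subseteq> S" "is_clique C" "clique_bound S (card C)"
    and IH: "\<And>T k. T \<subseteq> S \<Longrightarrow> \<not> ind_matching p T \<Longrightarrow> clique_bound T k \<Longrightarrow> col T (g k)"
  shows "col S (card C + (\<Sum>j = 2..card C. g j))"
proof -
  define m where "m = card C"
  have finC: "finite C"
    using fin C(1) finite_subset by blast
  obtain f where "bij_betw f {0..<m} C"
    using ex_bij_betw_nat_finite[OF finC] unfolding m_def by blast
  then have inj: "inj_on f {..<m}" and img: "f ` {..<m} = C"
    unfolding bij_betw_def atLeast0LessThan by blast+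
  have fS: "f i \<in> S" if "i < m" for i
    using that img C(1) by blast
  have fE: "E (f i) (f j)" if "i < m" "j < m" "i \<noteq> j" for i j
  proof -
    have "f i \<noteq> f j"
      using inj that unfolding inj_on_def by blast
    moreover have "f i \<in> C" "f j \<in> C"
      using img that by blast+
    ultimately show ?thesis
      using C(2) unfolding is_clique_def by blast
  qed
  \<comment> \<open>A member \<open>f l\<close> of the clique misses only itself among the clique,
    so it lies in \<open>J l\<close> and \<open>C\<close> needs no colours of its own.\<close>
  define J where "J i = {x \<in> S. \<not> E x (f i) \<and> (\<forall>l<m. l \<noteq> i \<longrightarrow> E x (f l))}" for i
  define D where "D i j = {x \<in> S. \<not> E x (f i) \<and> \<not> E x (f j) \<and> (\<forall>l<j. l \<noteq> i \<longrightarrow> E x (f l))}" for i j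
  have cover: "S \<subseteq> (\<Union>i\<in>{..<m}. J i) \<union> (\<Union>j\<in>{1..<m}. \<Union>i\<in>{..<j}. D i j)"
  proof
    fix x assume x: "x \<in> S"
    have "\<exists>i<m. \<not> E x (f i)"
    proof (rule ccontr)
      assume "\<not> ?thesis"
      then have all: "\<forall>y\<in>C. E x y"
        using img by auto
      then have "x \<notin> C"
        using E_irrefl by blast
      then have "card (insert x C) = Suc (card C)"
        using finC by simp
      moreover have "is_clique (insert x C)"
        using is_clique_Un[of "{x}" C] C(2) all by (simp add: is_clique_def[of "{x}"] complete_to_def)
      ultimately show False
        using C(1,3) x unfolding clique_bound_def by (metis Suc_n_not_le_n insert_subset)
    qed
    then obtain i where i: "i < m" "\<not> E x (f i)" "\<forall>l<i. E x (f l)"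
      using exists_least_iff[of "\<lambda>i. i < m \<and> \<not> E x (f i)"] by (meson less_trans)
    show "x \<in> (\<Union>i\<in>{..<m}. J i) \<union> (\<Union>j\<in>{1..<m}. \<Union>i\<in>{..<j}. D i j)"
    proof (cases "\<exists>j<m. j \<noteq> i \<and> \<not> E x (f j)")
      case False
      then have "x \<in> J i"
        unfolding J_def using x i by blast
      then show ?thesis using i(1) by blast
    next
      case True
      then obtain j where j: "j < m" "j \<noteq> i" "\<not> E x (f j)" "\<forall>l<j. l \<noteq> i \<longrightarrow> E x (f l)"
        using exists_least_iff[of "\<lambda>j. j < m \<and> j \<noteq> i \<and> \<not> E x (f j)"] by (meson less_trans)
      then have "i < j"
        using i(3) nat_neq_iff by blast
      moreover have "x \<in> D i j"
        unfolding D_def using x i j by blast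
      moreover have "j \<in> {1..<m}"
        using \<open>i < j\<close> j(1) by simp
      ultimately show ?thesis
        by blast
    qed
  qed
  \<comment> \<open>Two adjacent vertices of \<open>J i\<close> could replace \<open>f i\<close> in
    \<open>C\<close> and give a larger clique.\<close>
  have colJ: "col (J i) 1" if i: "i < m" for i
  proof (rule col_stable, unfold stable_def, intro ballI notI)
    fix x y assume xy: "x \<in> J i" "y \<in> J i" "E x y"
    have all: "E x w \<and> E y w" if "w \<in> C - {f i}" for w
      using that xy(1,2) img unfolding J_def by auto
    have "is_clique ({x, y} \<union> (C - {f i}))"
      using C(2) xy(3) E_sym[OF xy(3)] all
      by (intro is_clique_Un) (auto simp: is_clique_def complete_to_def)
    moreover have "{x, y} \<union> (C - {f i}) \<subseteq> S"
      using C(1) xy(1,2) unfolding J_def by blast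
    ultimately have "card ({x, y} \<union> (C - {f i})) \<le> card C"
      using C(3) unfolding clique_bound_def by blast
    moreover have "card ({x, y} \<union> (C - {f i})) = card {x, y} + card (C - {f i})"
      using all E_irrefl finC by (intro card_Un_disjoint) auto
    moreover have "x \<noteq> y"
      using xy(3) E_irrefl by blast
    moreover have "f i \<in> C"
      using img i by blast
    then have "card (C - {f i}) = card C - 1" "0 < card C"
      using finC by (auto simp: card_gt_0_iff)
    ultimately show False
      by simp
  qed
  \<comment> \<open>\<open>D i j\<close> is complete to the \<open>j - 1\<close> clique members
    before \<open>f j\<close> other than \<open>f i\<close>, so its cliques have at most
    \<open>m + 1 - j\<close> vertices. It is also far from the edge \<open>f i f j\<close>, which
    lowers \<open>p\<close>.\<close>
  have colD: "col (\<Union>i\<in>{..<j}. D i j) (g (m + 1 - j))" if j: "j \<in> {1..<m}" for j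
  proof (rule col_UN_anti)
    fix i assume i: "i \<in> {..<j}"
    then have ij: "i < m" "j < m" "i \<noteq> j" "i < j"
      using j by auto
    let ?B = "f ` ({..<j} - {i})"
    have "D i j \<subseteq> far (f i) (f j) S"
      unfolding D_def far_def using E_sym by blast
    then have "\<not> ind_matching p (D i j)"
      using not_ind_matching_far[OF free fS[OF ij(1)] fS[OF ij(2)] fE[OF ij(1-3)]] ind_matching_mono by blast
    moreover have sub: "D i j \<subseteq> S"
      unfolding D_def by blast
    moreover have "clique_bound (D i j) (m + 1 - j)"
      unfolding clique_bound_def
    proof (intro allI impI)
      fix Q assume Q: "Q \<subseteq> D i j" "is_clique Q"
      have BC: "?B \<subseteq> C"
        using img ij by auto
      have "card Q + card ?B \<le> card C"
      proof (rule clique_bound_complete[OF clique_bound_mono[OF C(3)] _ _ _ Q order_refl])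
        show "D i j \<union> ?B \<subseteq> S" using sub BC C(1) by blast
        show "complete_to (D i j) ?B" unfolding complete_to_def D_def by auto
        show "finite (D i j)" using sub fin finite_subset by blast
        show "is_clique ?B" using BC C(2) unfolding is_clique_def by blast
      qed simp
      moreover have "card ?B = j - 1"
      proof -
        have "inj_on f ({..<j} - {i})"
          by (rule inj_on_subset[OF inj]) (use ij in auto)
        then have "card ?B = card ({..<j} - {i})"
          by (rule card_image)
        also have "\<dots> = j - 1"
          using ij(4) by simp
        finally show ?thesis .
      qed
      ultimately show "card Q \<le> m + 1 - j"
        using ij unfolding m_def by linarith
    qed
    ultimately show "col (D i j) (g (m + 1 - j))"
      using IH by blast
  next
    fix i i' assume ii: "i \<in> {..<j}" "i' \<in> {..<j}" "i \<noteq> i'"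
    show "anti_to (D i j) (D i' j)"
      unfolding anti_to_def
    proof (intro ballI notI)
      fix x y assume xy: "x \<in> D i j" "y \<in> D i' j" "E x y"
      have x: "x \<in> S" "\<not> E x (f i)" "\<not> E x (f j)" "E x (f i')"
        and y: "y \<in> S" "\<not> E y (f i')" "\<not> E y (f j)" "E y (f i)"
        using xy(1,2) ii unfolding D_def by auto
      have lt: "i < m" "i' < m" "j < m" "j \<noteq> i" "j \<noteq> i'"
        using ii j by auto
      have f: "f i \<in> S" "f i' \<in> S" "f j \<in> S" "E (f i) (f i')" "E (f j) (f i)" "E (f j) (f i')"
        using fS fE lt ii(3) by simp_all
      \<comment> \<open>The four-cycle \<open>f i\<close>, \<open>f i'\<close>, \<open>x\<close>,
        \<open>y\<close> with roof \<open>f j\<close> is a house.\<close>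
      show False
        by (rule house_freeD[OF hf, of "f i" "f i'" x y "f j"]) (use f x y xy(3) E_sym in blast)+
    qed
  qed
  have "col ((\<Union>i\<in>{..<m}. J i) \<union> (\<Union>j\<in>{1..<m}. \<Union>i\<in>{..<j}. D i j))
      ((\<Sum>i\<in>{..<m}. 1) + (\<Sum>j\<in>{1..<m}. g (m + 1 - j)))"
    by (intro col_Un col_UN) (use colJ colD in auto)
  \<comment> \<open>Clique members are numbered from 0, so the second missed index runs from 1 to
    \<open>m - 1\<close> and \<open>m + 1 - j\<close> from \<open>m\<close> down to 2.\<close>
  moreover have "(\<Sum>j\<in>{1..<m}. g (m + 1 - j)) = (\<Sum>j = 2..m. g j)"
    by (rule sum.reindex_bij_witness[of _ "\<lambda>j. m + 1 - j" "\<lambda>j. m + 1 - j"]) auto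
  ultimately show ?thesis
    using cover unfolding m_def[symmetric] by (auto elim!: col_mono)
qed

text \<open>Numbers of colours are integers, hence the floor. An arbitrary upper bound
  \<open>n\<close> is allowed because only such a bound is known for the subsets met in
  \<open>col_wagon\<close>.\<close>

lemma col_chi_bound:
  assumes "2 \<le> p" "finite S" "\<not> ind_matching p S" "house_free S" "clique_bound S n"
  shows "col S (nat \<lfloor>chi_bound p n\<rfloor>)"
  using assms
proof (induction p arbitrary: S n rule: dec_induct)
  case base
  obtain Q where Q: "Q \<subseteq> S" "is_clique Q" "col S (3 * card Q div 2)"
    using good_col_2K2_house_free[OF base(1-3)] unfolding good_col_def by blast
  have "card Q \<le> n"
    using base(4) Q(1,2) unfolding clique_bound_def by blast
  then have "3 * card Q div 2 \<le> 3 * n div 2"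
    by (intro div_le_mono) simp
  \<comment> \<open>For \<open>n = 1\<close> rounding down gives exactly the exceptional value
    1.\<close>
  also have "real (3 * n div 2) \<le> chi_bound 2 n"
    by (cases "n < 2") (auto simp: less_2_cases_iff chi_bound_zero chi_bound_one[simplified] chi_bound_p2)
  then have "3 * n div 2 \<le> nat \<lfloor>chi_bound 2 n\<rfloor>"
    by (rule le_nat_floor)
  finally show ?case
    using col_mono[OF Q(3)] by blast
next
  case (step p)
  obtain C where C: "C \<subseteq> S" "is_clique C" "clique_bound S (card C)"
    using max_clique_exists[OF step.prems(1)] .
  have le: "card C \<le> n"
    using step.prems(4) C(1,2) unfolding clique_bound_def by blast
  have small: "card C \<ge> k" if "Q \<subseteq> S" "is_clique Q" "card Q = k" for Q k
    using that C(3) unfolding clique_bound_def by blast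
  \<comment> \<open>The exact clique number selects the applicable clause of
    \<open>chi_bound\<close>; the passage to \<open>n\<close> is left to monotonicity.\<close>
  have "\<exists>k. col S k \<and> real k \<le> chi_bound (Suc p) (card C)"
  proof -
    consider "card C = 0" | "card C = 1" | "card C = 2" | "3 \<le> card C" by linarith
    then show ?thesis
    proof cases
      case 1
      have "x \<notin> S" for x
        using small[of "{x}" 1] 1 by (auto simp: is_clique_def)
      then have "S = {}" by blast
      then show ?thesis
        using 1 col_empty by (intro exI[of _ 0]) (simp add: chi_bound_nonneg)
    next
      case 2
      have "stable S"
        unfolding stable_def
      proof (intro ballI notI)
        fix u v assume uv: "u \<in> S" "v \<in> S" "E u v"
        then have "u \<noteq> v" using E_irrefl by blast
        then show False
          using small[of "{u, v}" 2] uv 2 E_sym by (auto simp: is_clique_def)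
      qed
      then show ?thesis
        using 2 step.hyps chi_bound_one[of "Suc p"] col_stable by (intro exI[of _ 1]) simp
    next
      case 3
      have "triangle_free S"
        unfolding triangle_free_def
      proof (intro ballI notI)
        fix a b c assume abc: "a \<in> S" "b \<in> S" "c \<in> S" "E a b \<and> E b c \<and> E a c"
        then have "a \<noteq> b" "b \<noteq> c" "a \<noteq> c"
          using E_irrefl by blast+
        then have "card {a, b, c} = 3" by simp
        moreover have "is_clique {a, b, c}"
          using abc(4) E_sym unfolding is_clique_def by blast
        ultimately show False
          using small[of "{a, b, c}" 3] abc(1-3) 3 by simp
      qed
      then show ?thesis
        using 3 step.hyps step.prems col_triangle_free[of "Suc p" S] chi_bound_two[of "Suc p"]
        by (intro exI[of _ "2 * Suc p - 2"]) simp
    next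
      case 4
      have "col S (card C + (\<Sum>j = 2..card C. nat \<lfloor>chi_bound p j\<rfloor>))"
      proof (rule col_wagon[OF step.prems(1,3,2) C])
        fix T k assume T: "T \<subseteq> S" "\<not> ind_matching p T" "clique_bound T k"
        show "col T (nat \<lfloor>chi_bound p k\<rfloor>)"
          using T step.prems(1,3) house_free_mono
          by (intro step.IH) (auto intro: finite_subset)
      qed
      moreover have "real (\<Sum>j = 2..card C. nat \<lfloor>chi_bound p j\<rfloor>) \<le> (\<Sum>j = 2..card C. chi_bound p j)"
        unfolding of_nat_sum by (intro sum_mono) (simp add: chi_bound_nonneg)
      ultimately show ?thesis
        using 4 step.hyps chi_bound_rec[of "Suc p" "card C"]
        by (intro exI[of _ "card C + (\<Sum>j = 2..card C. nat \<lfloor>chi_bound p j\<rfloor>)"]) simp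
    qed
  qed
  then obtain k where k: "col S k" "real k \<le> chi_bound (Suc p) (card C)"
    by blast
  then have "k \<le> nat \<lfloor>chi_bound (Suc p) n\<rfloor>"
    using chi_bound_mono[OF _ le, of "Suc p"] step.hyps by (intro le_nat_floor) simp
  with k(1) show ?case
    using col_mono by blast
qed

end

section \<open>Transfer to graphs given by vertex and edge sets\<close>

lemma isomorphic_inducedI:
  fixes G :: "'a graph" and H :: "'b graph"
  assumes bij: "bij_betw g (verts H) S"
    and edge: "\<And>i j. i \<in> verts H \<Longrightarrow> j \<in> verts H \<Longrightarrow> {i, j} \<in> edges H \<longleftrightarrow> {g i, g j} \<in> edges G"
  shows "isomorphic (induced_subgraph G S) H"
proof -
  \<comment> \<open>Copies of \<open>H\<close> are found as maps out of \<open>H\<close>, while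
    \<open>free_of\<close> asks for an isomorphism onto \<open>H\<close>; hence the inverse.\<close>
  let ?f = "inv_into (verts H) g"
  have bij': "bij_betw ?f S (verts H)"
    using bij by (rule bij_betw_inv_into)
  have "{u, v} \<in> edges G \<longleftrightarrow> {?f u, ?f v} \<in> edges H" if "u \<in> S" "v \<in> S" for u v
    using edge[of "?f u" "?f v"] bij_betwE[OF bij'] bij_betw_inv_into_right[OF bij] that by simp
  with bij' show ?thesis
    unfolding isomorphic_def induced_subgraph_def by (intro exI[of _ ?f]) auto
qed

lemma edges_pK2:
  assumes "i < 2 * p" "j < 2 * p"
  shows "{i, j} \<in> edges (pK2 p) \<longleftrightarrow> i \<noteq> j \<and> i div 2 = j div 2"
proof
  assume "{i, j} \<in> edges (pK2 p)"
  then obtain k where "{i, j} = {2 * k, 2 * k + 1}"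
    unfolding pK2_def by auto
  then have "i = 2 * k \<and> j = 2 * k + 1 \<or> i = 2 * k + 1 \<and> j = 2 * k"
    by (auto simp: doubleton_eq_iff)
  then show "i \<noteq> j \<and> i div 2 = j div 2"
    by auto
next
  assume ij: "i \<noteq> j \<and> i div 2 = j div 2"
  define k where "k = i div 2"
  have "i = 2 * k \<and> j = 2 * k + 1 \<or> i = 2 * k + 1 \<and> j = 2 * k"
    using ij unfolding k_def by presburger
  then have "{i, j} = {2 * k, 2 * k + 1}"
    by auto
  moreover have "k < p"
    using assms unfolding k_def by simp
  ultimately show "{i, j} \<in> edges (pK2 p)"
    unfolding pK2_def by auto
qed

lemma (in sgraph) ind_matching_map:
  assumes "ind_matching p S"
  shows "\<exists>g. inj_on g {..<2 * p} \<and> g ` {..<2 * p} \<subseteq> S \<and>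
    (\<forall>i<2 * p. \<forall>j<2 * p. E (g i) (g j) \<longleftrightarrow> i \<noteq> j \<and> i div 2 = j div 2)"
  using assms
proof (induction p arbitrary: S)
  case 0
  show ?case by simp
next
  case (Suc p)
  obtain u v where uv: "u \<in> S" "v \<in> S" "E u v" "ind_matching p (far u v S)"
    using Suc.prems by auto
  from Suc.IH[OF uv(4)] obtain g where "inj_on g {..<2 * p} \<and> g ` {..<2 * p} \<subseteq> far u v S \<and>
    (\<forall>i<2 * p. \<forall>j<2 * p. E (g i) (g j) \<longleftrightarrow> i \<noteq> j \<and> i div 2 = j div 2)" ..
  then have g: "inj_on g {..<2 * p}" "g ` {..<2 * p} \<subseteq> far u v S"
    "\<And>i j. i < 2 * p \<Longrightarrow> j < 2 * p \<Longrightarrow> E (g i) (g j) \<longleftrightarrow> i \<noteq> j \<and> i div 2 = j div 2"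
    by simp_all
  have gf: "g i \<in> S" "\<not> E u (g i)" "\<not> E v (g i)" "\<not> E (g i) u" "\<not> E (g i) v" "g i \<noteq> u" "g i \<noteq> v"
    if "i < 2 * p" for i
  proof -
    have "g i \<in> far u v S"
      using g(2) that by blast
    then show "g i \<in> S" "\<not> E u (g i)" "\<not> E v (g i)" "\<not> E (g i) u" "\<not> E (g i) v" "g i \<noteq> u" "g i \<noteq> v"
      unfolding far_def using uv(3) E_sym by blast+
  qed
  \<comment> \<open>The new edge takes the indices 0 and 1. Shifting the old indices by two
    preserves which of them agree after division by 2.\<close>
  define h where "h n = (if n = 0 then u else if n = 1 then v else g (n - 2))" for n
  have h: "h 0 = u" "h (Suc 0) = v" "\<And>n. h (Suc (Suc n)) = g n"
    unfolding h_def by simp_all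
  have split: "n = 0 \<or> n = Suc 0 \<or> (\<exists>k<2 * p. n = Suc (Suc k))" if "n < 2 * Suc p" for n
    using that by (cases n; cases "n - 1") auto
  have uv': "u \<noteq> v" "E v u" "\<not> E u u" "\<not> E v v"
    using uv(3) E_sym E_irrefl by blast+
  have "h i \<in> S" if "i < 2 * Suc p" for i
    using split[OF that] uv gf(1) h by auto
  moreover have "E (h i) (h j) \<longleftrightarrow> i \<noteq> j \<and> i div 2 = j div 2" if "i < 2 * Suc p" "j < 2 * Suc p" for i j
    using split[OF that(1)] split[OF that(2)] uv(3) uv' gf g(3) h by (elim disjE exE) auto
  moreover have "inj_on h {..<2 * Suc p}"
  proof (rule inj_onI, rule ccontr)
    fix i j assume "i \<in> {..<2 * Suc p}" "j \<in> {..<2 * Suc p}" and eq: "h i = h j" "i \<noteq> j"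
    then have that: "i < 2 * Suc p" "j < 2 * Suc p"
      by simp_all
    show False
      using split[OF that(1)] split[OF that(2)] uv' gf(6,7) inj_onD[OF g(1)] h eq
      by (elim disjE exE) (auto dest: sym)
  qed
  ultimately show ?case
    by (intro exI[of _ h]) (simp add: image_subset_iff)
qed

lemma edges_house:
  assumes "i < 5" "j < 5"
  shows "{i, j} \<in> edges (complement_graph (path_graph 5)) \<longleftrightarrow> i \<noteq> j \<and> i \<noteq> Suc j \<and> j \<noteq> Suc i"
  using assms unfolding complement_graph_def path_graph_def by (auto simp: doubleton_eq_iff)

theorem theorem3p14:
  fixes G :: "'a graph" and p :: nat
  assumes "p \<ge> 2"
    and "finite_simple_graph G"
    and "free_of {pK2 p, complement_graph (path_graph 5)} G"
  shows "real (chromatic_number G) \<le> chi_bound p (clique_number G)"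
proof -
  define V where "V = verts G"
  define E where "E u v \<longleftrightarrow> {u, v} \<in> edges G" for u v
  have fin: "finite V" and edge: "\<And>e. e \<in> edges G \<Longrightarrow> e \<subseteq> V \<and> card e = 2"
    using assms(2) unfolding finite_simple_graph_def V_def by blast+
  interpret sgraph E
  proof
    show "E y x" if "E x y" for x y
      using that unfolding E_def by (simp add: insert_commute)
    show "\<not> E x x" for x
      using edge[of "{x}"] unfolding E_def by auto
  qed
  have free: "\<not> isomorphic (induced_subgraph G T) (pK2 p)"
    "\<not> isomorphic (induced_subgraph G T) (complement_graph (path_graph 5))" if "T \<subseteq> V" for T
    using assms(3) that unfolding free_of_def V_def by blast+
  have "\<not> ind_matching p V"
  proof
    assume "ind_matching p V"
    from ind_matching_map[OF this] obtain g where "inj_on g {..<2 * p} \<and> g ` {..<2 * p} \<subseteq> V \<and>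
      (\<forall>i<2 * p. \<forall>j<2 * p. E (g i) (g j) \<longleftrightarrow> i \<noteq> j \<and> i div 2 = j div 2)" ..
    then have g: "inj_on g {..<2 * p}" "g ` {..<2 * p} \<subseteq> V"
      "\<And>i j. i < 2 * p \<Longrightarrow> j < 2 * p \<Longrightarrow> E (g i) (g j) \<longleftrightarrow> i \<noteq> j \<and> i div 2 = j div 2"
      by simp_all
    have verts: "verts (pK2 p) = {..<2 * p}"
      unfolding pK2_def by simp
    have "isomorphic (induced_subgraph G (g ` {..<2 * p})) (pK2 p)"
    proof (rule isomorphic_inducedI, unfold verts)
      show "bij_betw g {..<2 * p} (g ` {..<2 * p})"
        using g(1) by (rule inj_on_imp_bij_betw)
      show "{i, j} \<in> edges (pK2 p) \<longleftrightarrow> {g i, g j} \<in> edges G" if "i \<in> {..<2 * p}" "j \<in> {..<2 * p}" for i j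
        using g(3)[of i j] edges_pK2[of i p j] that unfolding E_def by simp
    qed
    with free(1)[OF g(2)] show False by blast
  qed
  moreover have "house_free V"
    unfolding house_free_def
  proof (intro notI, elim bexE conjE)
    fix a b c d e
    assume V: "a \<in> V" "b \<in> V" "c \<in> V" "d \<in> V" "e \<in> V"
      and h: "E a b" "E b c" "E c d" "E d a" "\<not> E a c" "\<not> E b d" "E e a" "E e b" "\<not> E e c" "\<not> E e d"
    \<comment> \<open>The non-edges of the house form the path \<open>a c e d b\<close>, so this
      order identifies it with the complement of \<open>P_5\<close>.\<close>
    define g where "g = (!) [a, c, e, d, b]"
    have g: "g 0 = a" "g (Suc 0) = c" "g (Suc (Suc 0)) = e" "g (Suc (Suc (Suc 0))) = d"
      "g (Suc (Suc (Suc (Suc 0)))) = b"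
      unfolding g_def by simp_all
    have split: "n = 0 \<or> n = Suc 0 \<or> n = Suc (Suc 0) \<or> n = Suc (Suc (Suc 0)) \<or> n = Suc (Suc (Suc (Suc 0)))"
      if "n < 5" for n :: nat
      using that by linarith
    have verts: "verts (complement_graph (path_graph 5)) = {..<5}"
      unfolding complement_graph_def path_graph_def by simp
    have ne: "a \<noteq> b" "a \<noteq> c" "a \<noteq> d" "a \<noteq> e" "b \<noteq> c" "b \<noteq> d" "b \<noteq> e" "c \<noteq> d" "c \<noteq> e" "d \<noteq> e"
      using h E_sym E_irrefl by metis+
    have s: "E b a" "E c b" "E d c" "E a d" "\<not> E c a" "\<not> E d b" "E a e" "E b e" "\<not> E c e" "\<not> E d e"
      "\<not> E a a" "\<not> E b b" "\<not> E c c" "\<not> E d d" "\<not> E e e"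
      using h E_sym E_irrefl by blast+
    have "isomorphic (induced_subgraph G (g ` {..<5})) (complement_graph (path_graph 5))"
    proof (rule isomorphic_inducedI, unfold verts)
      have "g i \<noteq> g j" if "i < 5" "j < 5" "i \<noteq> j" for i j
        using split[OF that(1)] split[OF that(2)] that(3) g ne ne[symmetric] by (elim disjE) simp_all
      then show "bij_betw g {..<5} (g ` {..<5})"
        by (intro inj_on_imp_bij_betw) (auto simp: inj_on_def)
      have "E (g i) (g j) \<longleftrightarrow> i \<noteq> j \<and> i \<noteq> Suc j \<and> j \<noteq> Suc i" if "i < 5" "j < 5" for i j
        using split[OF that(1)] split[OF that(2)] g h s by (elim disjE) simp_all
      then show "{i, j} \<in> edges (complement_graph (path_graph 5)) \<longleftrightarrow> {g i, g j} \<in> edges G"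
        if "i \<in> {..<5}" "j \<in> {..<5}" for i j
        using edges_house[of i j] that unfolding E_def by simp
    qed
    moreover have "g ` {..<5} \<subseteq> V"
    proof (intro image_subsetI)
      fix i :: nat assume "i \<in> {..<5}"
      then show "g i \<in> V"
        using split[of i] g V by auto
    qed
    ultimately show False
      using free(2) by blast
  qed
  moreover have "clique_bound V (clique_number G)"
    unfolding clique_bound_def
  proof (intro allI impI)
    fix C assume C: "C \<subseteq> V" "is_clique C"
    then have "clique G C"
      unfolding clique_def is_clique_def E_def V_def by blast
    moreover have "finite {C. clique G C}"
      using fin finite_subset[of "{C. clique G C}" "Pow V"] unfolding clique_def V_def by blast
    ultimately show "card C \<le> clique_number G"
      unfolding clique_number_def by (intro Max_ge) auto
  qed
  ultimately have "col V (nat \<lfloor>chi_bound p (clique_number G)\<rfloor>)"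
    using col_chi_bound[OF assms(1) fin] by blast
  then obtain c where c: "\<forall>v\<in>V. c v < nat \<lfloor>chi_bound p (clique_number G)\<rfloor>"
    "\<forall>u\<in>V. \<forall>v\<in>V. E u v \<longrightarrow> c u \<noteq> c v"
    unfolding col_def by blast
  have "proper_colouring G (nat \<lfloor>chi_bound p (clique_number G)\<rfloor>) c"
    unfolding proper_colouring_def
  proof (intro conjI allI impI)
    show "\<forall>v\<in>verts G. c v < nat \<lfloor>chi_bound p (clique_number G)\<rfloor>"
      using c(1) unfolding V_def .
    show "c u \<noteq> c v" if "{u, v} \<in> edges G" for u v
      using c(2) edge[OF that] that unfolding E_def by blast
  qed
  then have "chromatic_number G \<le> nat \<lfloor>chi_bound p (clique_number G)\<rfloor>"
    unfolding chromatic_number_def by (intro Least_le) blast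
  then show ?thesis
    using chi_bound_nonneg[of p "clique_number G"] by linarith
qed

end
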